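(* Let $f$ be $L_f$-smooth and strongly convex with parameter $\mu\ge 0$ on the closed convex (possibly unbounded) set $Q\subseteq\mathbb{R}^n$, let $\|\tilde x_0-x^*\|_2\le R$ for some $R$, and let the stochastic gradient $\widetilde\nabla f(x,\xi)$ satisfy, for all (possibly random) $x\in Q$, $$\mathbb{E}_\xi\left[\|\widetilde\nabla f(x,\xi)-\nabla f(x)\|_2^2\,\Big|\,x\right]\le\delta^2.$$ Let $\{x_k\},\{\tilde x_k\},\{z_k\}$ be generated by the stochastic Algorithm STM$(L,\mu_\tau,x_{start})$ described in the context, and let $\tilde B_k$ be as in the context. (i) If $\mu\ne0$, then for all $N\ge0$: when the algorithm is run with $\tau=1$ (that is, $\mu_1=\mu$), $$\mathbb{E}f(x_N)-f(x^* )\le LR^2\exp\left(-\frac12\sqrt{\frac{\mu_1}{L}}\,N\right)+\left(1+\sqrt{\frac{L}{\mu_1}}\right)\delta_2+3\tilde B_N\delta_1,$$ and when the algorithm is run with $\tau=2$ (that is, $\mu_2=\mu/2$), $$\mathbb{E}f(x_N)-f(x^* )\le LR^2\exp\left(-\frac12\sqrt{\frac{\mu_2}{L}}\,N\right)+\left(1+\sqrt{\frac{L}{\mu_2}}\right)\delta_2+\left(1+\sqrt{\frac{L}{\mu_2}}\right)\delta_3.$$ (ii) If $\mu=0$ (so that $\mu_\tau=0$), then for all $N\ge1$, $$\mathbb{E}f(x_N)-f(x^* )\le\frac{4LR^2}{N^2}+3\tilde B_N\delta_1+N\delta_2.$$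
   Context: Setting: the problem is $\min_{x\in Q}f(x)$ and $x^*$ is a solution (if not unique, the one closest to $x_{start}$). $f$ is $L_f$-smooth: $\|\nabla f(x)-\nabla f(y)\|_2\le L_f\|x-y\|_2$ for all $x,y\in Q$; and strongly convex with parameter $\mu\ge 0$: $f(x)+\langle\nabla f(x),y-x\rangle+\frac{\mu}{2}\|x-y\|_2^2\le f(y)$ for all $x,y\in Q$ ($\mu=0$ means convex). The stochastic gradient is not assumed unbiased. At iteration $k$ a fresh sample $\xi_k$ is drawn, independent of the samples used before, so that the variance bound holds at $x=\tilde x_k$ conditionally on the past $\xi_0,\dots,\xi_{k-1}$. The starting point $x_{start}\in Q$ is deterministic. Constants: $L=2L_f$, $\delta_1=\delta$, $\delta_2=\delta^2/L$, $\delta_3=\delta^2/\mu$ (if $\mu\neq0$); $\mu_1=\mu$, $\mu_2=\mu/2$ ($\tau=2$ is used only when $\mu\ne0$). Stochastic Algorithm STM$(L,\mu_\tau,x_{start})$: set $\tilde x_0=x_{start}$, $\alpha_0=A_0=1/L$, $\psi_0(x)=\frac12\|x-\tilde x_0\|_2^2+\alpha_0\left(f(\tilde x_0)+\langle\widetilde\nabla f(\tilde x_0,\xi_0),x-\tilde x_0\rangle+\frac{\mu_\tau}{2}\|x-\tilde x_0\|_2^2\right)$, $z_0=\arg\min_{y\in Q}\psi_0(y)$, $x_0=z_0$. For $k=1,2,\dots$: let $\alpha_k=\frac{1+\mu_\tau A_{k-1}}{2L}+\sqrt{\frac{(1+\mu_\tau A_{k-1})^2}{4L^2}+\frac{A_{k-1}(1+\mu_\tau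 A_{k-1})}{L}}$ (the positive root of $(1+\mu_\tau A_{k-1})(A_{k-1}+\alpha_k)=L\alpha_k^2$), $A_k=A_{k-1}+\alpha_k$, $\tilde x_k=\frac{A_{k-1}x_{k-1}+\alpha_kz_{k-1}}{A_k}$, $\psi_k(x)=\psi_{k-1}(x)+\alpha_k\left(f(\tilde x_k)+\langle\widetilde\nabla f(\tilde x_k,\xi_k),x-\tilde x_k\rangle+\frac{\mu_\tau}{2}\|x-\tilde x_k\|_2^2\right)$, $z_k=\arg\min_{y\in Q}\psi_k(y)$, $x_k=\frac{A_{k-1}x_{k-1}+\alpha_kz_k}{A_k}$. Notation: $\tilde B_k=\max_{0\le j\le k}\max\{\mathbb{E}\|z_j-x^*\|_2,\mathbb{E}\|x_j-x^*\|_2,\mathbb{E}\|\tilde x_j-x^*\|_2\}$. *)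

theory Defs
  imports "HOL-Probability.Probability"
begin

text \<open>
  In what follows \<open>m\<close> is the strong convexity parameter handed to the method (\<open>\<mu>\<^sub>\<tau>\<close>),
  \<open>G p s\<close> is the stochastic gradient at \<open>p\<close> for the sample value \<open>s\<close>, and
  \<open>s :: nat \<Rightarrow> 's\<close> is a whole realisation of the sample sequence, so that the method is a
  deterministic function of \<open>s\<close>.
\<close>

text \<open>The positive root \<open>\<alpha>\<close> of \<open>(1 + m A) (A + \<alpha>) = L \<alpha>\<^sup>2\<close>.\<close>

definition stm_step :: "real \<Rightarrow> real \<Rightarrow> real \<Rightarrow> real" where
  "stm_step L m A =
     (1 + m * A) / (2 * L) + sqrt ((1 + m * A)\<^sup>2 / (4 * L\<^sup>2) + A * (1 + m * A) / L)"

primrec stm_A :: "real \<Rightarrow> real \<Rightarrow> nat \<Rightarrow> real" where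
  "stm_A L m 0 = 1 / L"
| "stm_A L m (Suc k) = stm_A L m k + stm_step L m (stm_A L m k)"

primrec stm_alpha :: "real \<Rightarrow> real \<Rightarrow> nat \<Rightarrow> real" where
  "stm_alpha L m 0 = 1 / L"
| "stm_alpha L m (Suc k) = stm_step L m (stm_A L m k)"

definition stm_model ::
  "('a::real_inner \<Rightarrow> real) \<Rightarrow> ('a \<Rightarrow> 's \<Rightarrow> 'a) \<Rightarrow> real \<Rightarrow> 's \<Rightarrow> 'a \<Rightarrow> 'a \<Rightarrow> real" where
  "stm_model f G m s p y = f p + inner (G p s) (y - p) + m / 2 * (norm (y - p))\<^sup>2"

text \<open>
  The state after iteration \<open>k\<close>: the point \<open>x\<tilde>\<^sub>k\<close> at which the stochastic gradient is queried,
  the function \<open>\<psi>\<^sub>k\<close>, its minimiser \<open>z\<^sub>k\<close> over \<open>Q\<close>, and the output \<open>x\<^sub>k\<close>.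
  For closed convex nonempty \<open>Q\<close> and \<open>m \<ge> 0\<close> the function \<open>\<psi>\<^sub>k\<close> is a strongly convex quadratic,
  so the choice made by \<open>arg_min_on\<close> is the unique minimiser.
\<close>

datatype 'a stm_state =
  STM_State (query_point: 'a) (psi_fun: "'a \<Rightarrow> real") (psi_minimiser: 'a) (output_point: 'a)

primrec stm ::
  "('a::real_inner) set \<Rightarrow> ('a \<Rightarrow> real) \<Rightarrow> ('a \<Rightarrow> 's \<Rightarrow> 'a) \<Rightarrow> real \<Rightarrow> real \<Rightarrow> 'a \<Rightarrow>
     (nat \<Rightarrow> 's) \<Rightarrow> nat \<Rightarrow> 'a stm_state" where
  "stm Q f G L m xstart s 0 =
    (let xt = xstart;
         psi = (\<lambda>y. 1 / 2 * (norm (y - xt))\<^sup>2 + stm_alpha L m 0 * stm_model f G m (s 0) xt y);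
         z = arg_min_on psi Q
     in STM_State xt psi z z)"
| "stm Q f G L m xstart s (Suc k) =
    (let S = stm Q f G L m xstart s k;
         A = stm_A L m k;
         A' = stm_A L m (Suc k);
         \<alpha> = stm_alpha L m (Suc k);
         xt = (1 / A') *\<^sub>R (A *\<^sub>R output_point S + \<alpha> *\<^sub>R psi_minimiser S);
         psi = (\<lambda>y. psi_fun S y + \<alpha> * stm_model f G m (s (Suc k)) xt y);
         z = arg_min_on psi Q;
         x = (1 / A') *\<^sub>R (A *\<^sub>R output_point S + \<alpha> *\<^sub>R z)
     in STM_State xt psi z x)"

text \<open>
  \<open>B\<tilde>\<^sub>k\<close>: the maximum, over \<open>0 \<le> j \<le> k\<close> and over the three random sequences \<open>z\<close>, \<open>x\<close>, \<open>x\<tilde>\<close>,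
  of the expected distance to \<open>x\<^sup>*\<close>.
\<close>

definition stm_B ::
  "'w measure \<Rightarrow> 'a::real_normed_vector \<Rightarrow> (nat \<Rightarrow> 'w \<Rightarrow> 'a) \<Rightarrow> (nat \<Rightarrow> 'w \<Rightarrow> 'a) \<Rightarrow>
     (nat \<Rightarrow> 'w \<Rightarrow> 'a) \<Rightarrow> nat \<Rightarrow> real" where
  "stm_B M xstar z x xt k =
     (MAX j\<in>{0..k}. Max {(\<integral>\<omega>. norm (z j \<omega> - xstar) \<partial>M),
                          (\<integral>\<omega>. norm (x j \<omega> - xstar) \<partial>M),
                          (\<integral>\<omega>. norm (xt j \<omega> - xstar) \<partial>M)})"

end

(*
Let e_k be the error of the stochastic gradient at xt_k, and put
W_k = A_k (f(x_k) - f(x_star)) - psi_k(z_k) + psi_k(x_star) (the quantity gap below). Strong convexity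
of psi_k gives A_k (f(x_k) - f(x_star)) + (1 + m A_k) / 2 |z_k - x_star|^2 <= W_k, and one step of the
method increases W by at most
  alpha_k <e_k, x_star - z_k> - (1 + m A_(k-1)) / 4 |z_k - z_(k-1)|^2
plus nonpositive terms, because the errors against x_(k-1) and against x_star combine at z_k. Since
(1 + m A_(k-1)) A_k = L alpha_k^2, Young's inequality bounds the increment by
alpha_k |e_k| |z_(k-1) - x_star| + A_k |e_k|^2 / L, and z_(k-1) is independent of the k-th sample, so the
expectation is at most alpha_k delta B + A_k delta^2 / L. For m = mu / 2 the remaining curvature mu / 2
absorbs the inner products instead. It remains to bound A_N from below and the sum of the A_k by a
multiple of A_N.

In the convex case the sum of the A_k is at most N A_N only for N >= 2. For N = 1 the term
|z_1 - x_star|^2 / 2 and the exact quadratic form in |z_0 - x_star|, |z_1 - x_star| are needed.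
*)
theory Submission
  imports Defs
begin

text \<open>The gradient error need not have mean zero, so its inner product with x_star - z_k
  cannot be averaged away and has to be bounded by norms. As z_k itself depends on the k-th sample,
  independence applies only after z_k is replaced by z_(k-1), at the price of the move |z_k -
  z_(k-1)|. The choice L = 2 L_f pays for it: the quadratic upper bound on f then has coefficient L
  / 4 and uses up only half of the curvature of psi, and the other half is the negative square of
  that move. As Q may be unbounded, no diameter bounds |z_(k-1) - x_star|. Its expectation has to be
  shown finite, by following first moments through the projection onto Q that computes z_k. The
  inequality m \<le> L behind the exponential rate is derived from the existence of two distinct
  points in Q; a one-point Q is treated apart.\<close>

section \<open>Smoothness, projections and Young inequalities\<close>

lemma smooth_upper_bound:
  fixes f :: "'a::real_inner \<Rightarrow> real"
  assumes "convex Q"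
    and deriv: "\<And>u. u \<in> Q \<Longrightarrow> (f has_derivative (\<lambda>h. inner (grad u) h)) (at u within Q)"
    and lip: "\<And>u v. u \<in> Q \<Longrightarrow> v \<in> Q \<Longrightarrow> norm (grad u - grad v) \<le> K * norm (u - v)"
    and u: "u \<in> Q" and v: "v \<in> Q"
  shows "f v \<le> f u + inner (grad u) (v - u) + K / 2 * (norm (v - u))\<^sup>2"
proof -
  define d where "d = v - u"
  define p where "p t = u + t *\<^sub>R d" for t :: real
  \<comment> \<open>The claimed bound is subtracted along the segment, so that the derivative of
    \<open>h\<close> is at most 0. A single mean value point then suffices, and no gradient has to
    be integrated.\<close>
  define h where "h t = f (p t) - t * inner (grad u) d - K / 2 * t\<^sup>2 * (norm d)\<^sup>2" for t
  define h' where "h' t s = s * (inner (grad (p t) - grad u) d - K * t * (norm d)\<^sup>2)" for t s :: real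
  have pQ: "p t \<in> Q" if "t \<in> {0..1}" for t
  proof -
    have "p t = (1 - t) *\<^sub>R u + t *\<^sub>R v" by (simp add: p_def d_def algebra_simps)
    then show ?thesis using that \<open>convex Q\<close> u v by (simp add: convexD_alt)
  qed
  have "(h has_derivative h' t) (at t within {0..1})" if t: "t \<in> {0..1}" for t
  proof -
    have p: "(p has_derivative (\<lambda>s. s *\<^sub>R d)) (at t within {0..1})"
      unfolding p_def by (auto intro!: derivative_eq_intros)
    have f: "(f has_derivative (\<lambda>h. inner (grad (p t)) h)) (at (p t) within p ` {0..1})"
      by (rule has_derivative_subset[OF deriv[OF pQ[OF t]]]) (use pQ in auto)
    have "((\<lambda>t. f (p t)) has_derivative (\<lambda>s. inner (grad (p t)) (s *\<^sub>R d))) (at t within {0..1})"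
      using has_derivative_in_compose[OF p f] .
    then show ?thesis unfolding h_def h'_def
      by (auto intro!: derivative_eq_intros simp: algebra_simps inner_diff_left power2_eq_square)
  qed
  then obtain t where t: "t \<in> {0..1}" "h 1 - h 0 = h' t (1 - 0)"
    using mvt_very_simple[of 0 1 h h'] by auto
  have "inner (grad (p t) - grad u) d \<le> norm (grad (p t) - grad u) * norm d"
    by (rule norm_cauchy_schwarz)
  also have "\<dots> \<le> (K * norm (p t - u)) * norm d"
    by (intro mult_right_mono lip pQ t u) simp
  also have "\<dots> = K * t * (norm d)\<^sup>2"
    using t by (simp add: p_def power2_eq_square)
  finally have "h' t (1 - 0) \<le> 0" by (simp add: h'_def)
  with t have "h 1 \<le> h 0" by simp
  then show ?thesis by (simp add: h_def p_def d_def)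
qed

text \<open>Completing the square makes \<open>psi\<close> a constant plus \<sigma>/2 times the
  squared distance to \<open>(- 1 / \<sigma>) *\<^sub>R b\<close>, so the minimiser is a projection.
  The variational inequality of the projection gives the growth, and growth forces uniqueness, which
  pins down the choice made by \<open>arg_min_on\<close>. The projection form later yields
  measurability and integrability of the minimisers.\<close>

lemma
  fixes Q :: "'a::euclidean_space set"
  assumes "closed Q" "convex Q" "Q \<noteq> {}" "\<sigma> > 0"
    and psi: "\<And>y. psi y = c + inner b y + \<sigma> / 2 * (norm y)\<^sup>2"
  shows arg_min_on_quadratic: "arg_min_on psi Q = closest_point Q ((- 1 / \<sigma>) *\<^sub>R b)"
    and arg_min_on_quadratic_growth:
      "y \<in> Q \<Longrightarrow> psi (arg_min_on psi Q) + \<sigma> / 2 * (norm (y - arg_min_on psi Q))\<^sup>2 \<le> psi y"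
proof -
  define p where "p = (- 1 / \<sigma>) *\<^sub>R b"
  define z where "z = closest_point Q p"
  have b: "b = (- \<sigma>) *\<^sub>R p" using \<open>\<sigma> > 0\<close> by (simp add: p_def)
  have zQ: "z \<in> Q" unfolding z_def by (rule closest_point_in_set[OF assms(1,3)])
  have growth: "psi z + \<sigma> / 2 * (norm (y - z))\<^sup>2 \<le> psi y" if "y \<in> Q" for y
  proof -
    have "inner (p - z) (y - z) \<le> 0"
      unfolding z_def by (rule closest_point_dot[OF assms(2,1) that])
    then have "\<sigma> * inner (p - z) (y - z) \<le> 0" using \<open>\<sigma> > 0\<close>
      by (simp add: mult_le_0_iff)
    then show ?thesis unfolding psi b power2_norm_eq_inner
      by (simp add: inner_diff inner_commute algebra_simps)
  qed
  have "is_arg_min psi (\<lambda>y. y \<in> Q) z"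
    unfolding is_arg_min_linorder using zQ growth \<open>\<sigma> > 0\<close>
    by (smt (verit) mult_nonneg_nonneg zero_le_divide_iff zero_le_power2)
  then have "is_arg_min psi (\<lambda>y. y \<in> Q) (arg_min_on psi Q)"
    unfolding arg_min_on_def arg_min_def by (rule someI)
  then have "arg_min_on psi Q \<in> Q" "psi (arg_min_on psi Q) \<le> psi z"
    using zQ unfolding is_arg_min_linorder by auto
  with growth[of "arg_min_on psi Q"] have "\<sigma> / 2 * (norm (arg_min_on psi Q - z))\<^sup>2 \<le> 0" by simp
  then have eq: "arg_min_on psi Q = z" using \<open>\<sigma> > 0\<close>
    by (simp add: mult_le_0_iff)
  then show "arg_min_on psi Q = closest_point Q ((- 1 / \<sigma>) *\<^sub>R b)"
    by (simp add: z_def p_def)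
  show "psi (arg_min_on psi Q) + \<sigma> / 2 * (norm (y - arg_min_on psi Q))\<^sup>2 \<le> psi y" if "y \<in> Q"
    using growth[OF that] eq by simp
qed

text \<open>The weights are skewed to produce c / 4: for c = 1 + m A this is the curvature left over
  by smoothness, for c = \<mu> it is half of the coefficient in strong convexity.\<close>

lemma young_le:
  fixes a b c :: real
  assumes "c > 0"
  shows "a * b \<le> a\<^sup>2 / c + c / 4 * b\<^sup>2"
proof -
  have "0 \<le> (a - c / 2 * b)\<^sup>2 / c" using assms by simp
  also have "\<dots> = a\<^sup>2 / c + c / 4 * b\<^sup>2 - a * b"
    using assms by (simp add: power2_eq_square field_simps)
  finally show ?thesis by simp
qed

text \<open>Serves the convex case N = 1. In (u, v - u) the negative part is -1/2 times a quadratic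
  form whose matrix has 3/2 on the diagonal and 1 off it; the inverse matrix is 4/5 times the one
  with 3/2 and -1, whence 3/5 = 1/2 * 4/5 * 3/2. Two separate Young inequalities would give the
  coefficient 1, which is too large there.\<close>

lemma young_chain:
  fixes g q u v :: real
  assumes "g \<ge> 0" "q \<ge> 0"
  shows "g * u + q * (v - u) - u\<^sup>2 / 4 - (v - u)\<^sup>2 / 4 - v\<^sup>2 / 2 \<le> 3 / 5 * g\<^sup>2 + 3 / 5 * q\<^sup>2"
proof -
  \<comment> \<open>complete the square around the maximiser of the concave quadratic form in \<open>(u, v - u)\<close>\<close>
  define a where "a = u - 4 / 5 * (3 / 2 * g - q)"
  define b where "b = (v - u) - 4 / 5 * (3 / 2 * q - g)"
  have "g * u + q * (v - u) - u\<^sup>2 / 4 - (v - u)\<^sup>2 / 4 - v\<^sup>2 / 2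
      = 3 / 5 * g\<^sup>2 + 3 / 5 * q\<^sup>2 - 4 / 5 * (g * q) - ((a + b)\<^sup>2 / 2 + a\<^sup>2 / 4 + b\<^sup>2 / 4)"
    unfolding a_def b_def power2_eq_square by (simp add: field_simps)
  moreover have "0 \<le> g * q" "0 \<le> (a + b)\<^sup>2 / 2 + a\<^sup>2 / 4 + b\<^sup>2 / 4" using assms by simp_all
  ultimately show ?thesis by linarith
qed

section \<open>Step sizes\<close>

lemma stm_step_pos:
  assumes "L > 0" "m \<ge> 0" "A \<ge> 0"
  shows "stm_step L m A > 0"
proof -
  have "(1 + m * A) / (2 * L) > 0" using assms by (simp add: add_pos_nonneg)
  moreover have "sqrt ((1 + m * A)\<^sup>2 / (4 * L\<^sup>2) + A * (1 + m * A) / L) \<ge> 0" using assms by simp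
  ultimately show ?thesis unfolding stm_step_def by linarith
qed

lemma stm_step_root:
  assumes "L > 0" "m \<ge> 0" "A \<ge> 0"
  shows "(1 + m * A) * (A + stm_step L m A) = L * (stm_step L m A)\<^sup>2"
proof -
  define c where "c = 1 + m * A"
  define s where "s = sqrt (c\<^sup>2 / (4 * L\<^sup>2) + A * c / L)"
  have "c \<ge> 0" using assms by (simp add: c_def)
  then have s: "s\<^sup>2 = c\<^sup>2 / (4 * L\<^sup>2) + A * c / L" unfolding s_def using assms by simp
  have "L * (c / (2 * L) + s)\<^sup>2 = c\<^sup>2 / (4 * L) + c * s + L * s\<^sup>2"
    using assms by (simp add: field_simps power2_eq_square)
  also have "L * s\<^sup>2 = c\<^sup>2 / (4 * L) + A * c"
    unfolding s using assms by (simp add: field_simps power2_eq_square)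
  also have "c\<^sup>2 / (4 * L) + c * s + (c\<^sup>2 / (4 * L) + A * c) = c * (A + (c / (2 * L) + s))"
    using assms by (simp add: field_simps power2_eq_square)
  finally have "c * (A + (c / (2 * L) + s)) = L * (c / (2 * L) + s)\<^sup>2"
    using assms by (simp add: algebra_simps)
  then show ?thesis by (simp add: stm_step_def c_def s_def)
qed

lemma stm_A_pos: "L > 0 \<Longrightarrow> m \<ge> 0 \<Longrightarrow> stm_A L m k > 0"
  by (induction k) (auto intro!: add_pos_pos stm_step_pos)

lemma stm_alpha_pos: "L > 0 \<Longrightarrow> m \<ge> 0 \<Longrightarrow> stm_alpha L m k > 0"
  by (cases k) (auto intro!: stm_step_pos less_imp_le[OF stm_A_pos])

lemma stm_A_eq_sum: "stm_A L m k = (\<Sum>i\<le>k. stm_alpha L m i)"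
  by (induction k) auto

lemma stm_A_root:
  assumes "L > 0" "m \<ge> 0"
  shows "(1 + m * stm_A L m k) * stm_A L m (Suc k) = L * (stm_alpha L m (Suc k))\<^sup>2"
  using stm_step_root[OF assms less_imp_le[OF stm_A_pos[OF assms]], of k] by simp

text \<open>With q = sqrt (m / L), the square root in \<open>stm_step\<close> is at least A q and
  the summand in front of it is at least A q^2 / 2.\<close>

lemma stm_A_growth:
  assumes "L > 0" "m \<ge> 0"
  shows "stm_A L m k * (1 + sqrt (m / L) + (sqrt (m / L))\<^sup>2 / 2) \<le> stm_A L m (Suc k)"
proof -
  define A where "A = stm_A L m k"
  have A: "A > 0" unfolding A_def using assms by (rule stm_A_pos)
  have "A * sqrt (m / L) = sqrt (A\<^sup>2 * (m / L))" using A by (simp only: real_sqrt_mult real_sqrt_abs abs_of_pos)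
  also have "\<dots> \<le> sqrt ((1 + m * A)\<^sup>2 / (4 * L\<^sup>2) + A * (1 + m * A) / L)"
  proof (rule real_sqrt_le_mono)
    have "A\<^sup>2 * (m / L) \<le> A * (1 + m * A) / L"
      using A assms by (simp add: divide_simps power2_eq_square algebra_simps)
    moreover have "0 \<le> (1 + m * A)\<^sup>2 / (4 * L\<^sup>2)" by simp
    ultimately show "A\<^sup>2 * (m / L) \<le> (1 + m * A)\<^sup>2 / (4 * L\<^sup>2) + A * (1 + m * A) / L" by linarith
  qed
  moreover have "A * ((sqrt (m / L))\<^sup>2 / 2) \<le> (1 + m * A) / (2 * L)"
    using assms by (simp add: field_simps)
  ultimately have "A * (1 + sqrt (m / L) + (sqrt (m / L))\<^sup>2 / 2) \<le> A + stm_step L m A"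
    unfolding stm_step_def by (simp only: distrib_left mult_1_right)
  then show ?thesis by (simp add: A_def)
qed

text \<open>Growth by the factor 1 + q lets the last term dominate: read backwards, the sum lies
  below a geometric series of ratio 1 / (1 + q), whose total is 1 + 1 / q.\<close>

lemma sum_stm_A_le:
  assumes "L > 0" "m > 0"
  shows "(\<Sum>k\<le>N. stm_A L m k) \<le> (1 + sqrt (L / m)) * stm_A L m N"
proof (induction N)
  case 0
  then show ?case using stm_A_pos[of L m 0] assms by (simp add: divide_right_mono)
next
  case (Suc N)
  define q where "q = sqrt (m / L)"
  have q: "q > 0" and q': "sqrt (L / m) = 1 / q"
    using assms by (simp_all add: q_def real_sqrt_divide)
  have "stm_A L m N * (1 + q) \<le> stm_A L m N * (1 + q + q\<^sup>2 / 2)"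
    using stm_A_pos[of L m N] assms by (intro mult_left_mono) auto
  also have "\<dots> \<le> stm_A L m (Suc N)"
    unfolding q_def using assms by (intro stm_A_growth) auto
  finally have "(1 + 1 / q) * stm_A L m N \<le> (1 / q) * stm_A L m (Suc N)"
    using q by (simp add: field_simps del: stm_A.simps) (simp add: distrib_left[symmetric] del: stm_A.simps)
  with Suc show ?case unfolding q' by (simp add: algebra_simps del: stm_A.simps)
qed

lemma stm_A_ge_exp:
  assumes "L > 0" "m > 0" "m \<le> L"
  shows "exp (1 / 2 * sqrt (m / L) * real N) \<le> L * stm_A L m N"
proof (induction N)
  case 0
  then show ?case using assms by simp
next
  case (Suc N)
  define q where "q = sqrt (m / L)"
  have q: "0 \<le> q" "q \<le> 1" using assms by (auto simp: q_def)
  \<comment> \<open>\<open>exp_bound\<close> is exp t <= 1 + t + t^2 for t in [0, 1]; the hypothesis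
    m \<le> L brings t = q / 2 into that range.\<close>
  have "exp (q / 2) \<le> 1 + q / 2 + (q / 2)\<^sup>2" using q by (intro exp_bound) auto
  also have "\<dots> \<le> 1 + q + q\<^sup>2 / 2" using q zero_le_power2[of q]
    unfolding power_divide power2_eq_square[of 2] by linarith
  finally have "exp (1 / 2 * q * real N) * exp (q / 2) \<le> (L * stm_A L m N) * (1 + q + q\<^sup>2 / 2)"
    using Suc unfolding q_def[symmetric] by (intro mult_mono) (use assms stm_A_pos[of L m N] in auto)
  also have "\<dots> \<le> L * stm_A L m (Suc N)"
    unfolding q_def using stm_A_growth[of L m N] assms
    by (simp only: mult.assoc mult_le_cancel_left_pos less_imp_le)
  finally show ?case unfolding q_def[symmetric]
    by (simp add: exp_add[symmetric] algebra_simps add_divide_distrib del: stm_A.simps)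
qed

lemma stm_step_0_ge:
  assumes "L > 0" "A \<ge> 0"
  shows "1 / (2 * L) + sqrt (A / L) \<le> stm_step L 0 A"
  using assms by (simp add: stm_step_def)

lemma stm_step_0_ge_inverse:
  assumes "L > 0" "A \<ge> 1 / L"
  shows "1 / L \<le> stm_step L 0 A"
proof -
  have "(1 / (2 * L))\<^sup>2 \<le> A / L"
    using assms by (simp add: field_simps power2_eq_square)
  then have "1 / (2 * L) \<le> sqrt (A / L)" by (rule real_le_rsqrt)
  moreover have "0 \<le> A" using assms by (meson less_imp_le order_trans zero_le_divide_1_iff)
  ultimately show ?thesis
    using stm_step_0_ge[of L A] assms(1) by (simp add: field_simps)
qed

lemma stm_A_0_ge:
  assumes "L > 0"
  shows "(real k + 1)\<^sup>2 / (4 * L) \<le> stm_A L 0 k"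
proof (induction k)
  case 0
  then show ?case using assms by (simp add: divide_right_mono field_simps)
next
  case (Suc k)
  have "(real k + 1) / (2 * L) = sqrt (((real k + 1)\<^sup>2 / (4 * L)) / L)"
    using assms by (simp add: real_sqrt_divide real_sqrt_mult field_simps)
  also have "\<dots> \<le> sqrt (stm_A L 0 k / L)"
    by (intro real_sqrt_le_mono divide_right_mono Suc less_imp_le[OF assms])
  finally have "1 / (2 * L) + (real k + 1) / (2 * L) \<le> stm_step L 0 (stm_A L 0 k)"
    using stm_step_0_ge[OF assms, of "stm_A L 0 k"] stm_A_pos[of L 0 k] assms by simp
  with Suc have "(real k + 1)\<^sup>2 / (4 * L) + (1 / (2 * L) + (real k + 1) / (2 * L)) \<le> stm_A L 0 (Suc k)"
    by simp
  \<comment> \<open>The increment (2 k + 4) / (4 L) exceeds the difference (2 k + 3) / (4 L) of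
    consecutive squares.\<close>
  moreover have "(real (Suc k) + 1)\<^sup>2 / (4 * L)
      \<le> (real k + 1)\<^sup>2 / (4 * L) + (1 / (2 * L) + (real k + 1) / (2 * L))"
    using assms by (simp add: field_simps power2_eq_square)
  ultimately show ?case by linarith
qed

text \<open>Monotonicity alone bounds the N + 1 summands by (N + 1) A_N. The surplus summand A_0 is
  absorbed once, in the base case: A_0 = 1 / L is at most the step from A_1 to A_2, hence A_0 + A_1
  <= A_2.\<close>

lemma sum_stm_A_0_le:
  assumes "L > 0" "N \<ge> 2"
  shows "(\<Sum>k\<le>N. stm_A L 0 k) \<le> real N * stm_A L 0 N"
  using \<open>N \<ge> 2\<close>
proof (induction N rule: nat_induct_at_least)
  case base
  have "1 / L \<le> stm_A L 0 1" using stm_step_pos[of L 0 "1 / L"] assms(1) by simp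
  then have "stm_A L 0 0 \<le> stm_step L 0 (stm_A L 0 1)"
    using stm_step_0_ge_inverse[OF assms(1)] by simp
  then show ?case by (simp add: numeral_2_eq_2)
next
  case (Suc N)
  have "stm_A L 0 N \<le> stm_A L 0 (Suc N)"
    using stm_step_pos[of L 0 "stm_A L 0 N"] stm_A_pos[of L 0 N] assms(1) by simp
  then have "real N * stm_A L 0 N \<le> real N * stm_A L 0 (Suc N)" by (intro mult_left_mono) auto
  with Suc show ?case by (simp add: algebra_simps)
qed

section \<open>The potential along a single run\<close>

text \<open>No probability enters here: everything holds for each realisation \<open>s\<close>.
  Letting \<open>m\<close> range over [0, \<mu>] makes the runs with \<mu>, \<mu>/2 and 0 instances
  of one analysis. The Lipschitz constant L / 2 encodes L = 2 L_f.\<close>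

locale stm_problem =
  fixes Q :: "'a::euclidean_space set"
    and f :: "'a \<Rightarrow> real"
    and grad :: "'a \<Rightarrow> 'a"
    and G :: "'a \<Rightarrow> 's \<Rightarrow> 'a"
    and xstart xstar :: 'a
    and L \<mu> m :: real
  assumes Q: "closed Q" "convex Q"
    and xstart: "xstart \<in> Q"
    and deriv: "\<And>u. u \<in> Q \<Longrightarrow> (f has_derivative (\<lambda>h. inner (grad u) h)) (at u within Q)"
    and L: "L > 0"
    and smooth: "\<And>u v. u \<in> Q \<Longrightarrow> v \<in> Q \<Longrightarrow> norm (grad u - grad v) \<le> L / 2 * norm (u - v)"
    and strongly_convex: "\<And>u v. u \<in> Q \<Longrightarrow> v \<in> Q \<Longrightarrow>
          f u + inner (grad u) (v - u) + \<mu> / 2 * (norm (u - v))\<^sup>2 \<le> f v"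
    and m: "0 \<le> m" "m \<le> \<mu>"
    and xstar: "xstar \<in> Q" "\<And>u. u \<in> Q \<Longrightarrow> f xstar \<le> f u"
begin

abbreviation "A \<equiv> stm_A L m"
abbreviation "\<alpha> \<equiv> stm_alpha L m"
abbreviation "xt s k \<equiv> query_point (stm Q f G L m xstart s k)"
abbreviation "psi s k \<equiv> psi_fun (stm Q f G L m xstart s k)"
abbreviation "z s k \<equiv> psi_minimiser (stm Q f G L m xstart s k)"
abbreviation "x s k \<equiv> output_point (stm Q f G L m xstart s k)"

definition err :: "(nat \<Rightarrow> 's) \<Rightarrow> nat \<Rightarrow> 'a" where
  "err s k = G (xt s k) (s k) - grad (xt s k)"

text \<open>The linear coefficient of psi_k expanded around the origin. The minimiser depends on the
  samples only through it, so measurability and integrability of z_k reduce to those of a finite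
  sum.\<close>

definition lin :: "(nat \<Rightarrow> 's) \<Rightarrow> nat \<Rightarrow> 'a" where
  "lin s k = (\<Sum>i\<le>k. \<alpha> i *\<^sub>R (G (xt s i) (s i) - m *\<^sub>R xt s i)) - xstart"

definition gap :: "(nat \<Rightarrow> 's) \<Rightarrow> nat \<Rightarrow> real" where
  "gap s k = A k * (f (x s k) - f xstar) - psi s k (z s k) + psi s k xstar"

lemma A_pos: "A k > 0" and \<alpha>_pos: "\<alpha> k > 0"
  using L m by (auto intro: stm_A_pos stm_alpha_pos)

lemma A_Suc: "A (Suc k) = A k + \<alpha> (Suc k)"
  by simp

lemma A_root: "(1 + m * A k) * A (Suc k) = L * (\<alpha> (Suc k))\<^sup>2"
  using stm_A_root L m by blast

lemma xt_Suc: "xt s (Suc k) = (1 / A (Suc k)) *\<^sub>R (A k *\<^sub>R x s k + \<alpha> (Suc k) *\<^sub>R z s k)"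
  and x_Suc: "x s (Suc k) = (1 / A (Suc k)) *\<^sub>R (A k *\<^sub>R x s k + \<alpha> (Suc k) *\<^sub>R z s (Suc k))"
  and psi_Suc: "psi s (Suc k) y = psi s k y + \<alpha> (Suc k) * stm_model f G m (s (Suc k)) (xt s (Suc k)) y"
  by (simp_all add: Let_def)

lemma xt_0: "xt s 0 = xstart" and x_0: "x s 0 = z s 0"
  and psi_0: "psi s 0 y = 1 / 2 * (norm (y - xstart))\<^sup>2 + \<alpha> 0 * stm_model f G m (s 0) xstart y"
  by (simp_all add: Let_def)

lemma z_arg_min: "z s k = arg_min_on (psi s k) Q"
  by (cases k) (simp_all add: Let_def)

declare stm.simps [simp del]

lemma stm_model_quadratic:
  "stm_model f G m t p y = (f p - inner (G p t) p + m / 2 * (norm p)\<^sup>2)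
     + inner (G p t - m *\<^sub>R p) y + m / 2 * (norm y)\<^sup>2"
  unfolding stm_model_def power2_norm_eq_inner
  by (simp add: inner_diff inner_commute algebra_simps)

lemma psi_quadratic:
  "\<exists>c. \<forall>y. psi s k y = c + inner (lin s k) y + (1 + m * A k) / 2 * (norm y)\<^sup>2"
proof (induction k)
  case 0
  let ?g = "f xstart - inner (G xstart (s 0)) xstart + m / 2 * (norm xstart)\<^sup>2"
  have "psi s 0 y = ((norm xstart)\<^sup>2 / 2 + \<alpha> 0 * ?g) + inner (lin s 0) y
      + (1 + m * A 0) / 2 * (norm y)\<^sup>2" for y
    unfolding psi_0 stm_model_quadratic lin_def power2_norm_eq_inner
    by (simp add: xt_0 inner_diff inner_commute add_divide_distrib algebra_simps)
  then show ?case by blast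
next
  case (Suc k)
  then obtain c where c: "psi s k y = c + inner (lin s k) y + (1 + m * A k) / 2 * (norm y)\<^sup>2" for y
    by blast
  define p where "p = xt s (Suc k)"
  define t where "t = s (Suc k)"
  define a where "a = \<alpha> (Suc k)"
  have lin: "lin s (Suc k) = lin s k + a *\<^sub>R (G p t - m *\<^sub>R p)"
    unfolding lin_def p_def t_def a_def by simp
  have "psi s (Suc k) y = (c + a * (f p - inner (G p t) p + m / 2 * (norm p)\<^sup>2))
      + inner (lin s (Suc k)) y + (1 + m * A (Suc k)) / 2 * (norm y)\<^sup>2" for y
    unfolding psi_Suc c stm_model_quadratic A_Suc lin p_def[symmetric] t_def[symmetric] a_def[symmetric]
    by (simp add: inner_add_left inner_diff_left field_simps)
  then show ?case by blast
qed

lemma quadratic_coeff_pos: "1 + m * A k > 0"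
  using A_pos[of k] m by (simp add: add_pos_nonneg)

lemma z_eq: "z s k = closest_point Q ((- 1 / (1 + m * A k)) *\<^sub>R lin s k)"
  and psi_growth: "y \<in> Q \<Longrightarrow> psi s k (z s k) + (1 + m * A k) / 2 * (norm (y - z s k))\<^sup>2 \<le> psi s k y"
proof -
  obtain c where c: "\<And>y. psi s k y = c + inner (lin s k) y + (1 + m * A k) / 2 * (norm y)\<^sup>2"
    using psi_quadratic by blast
  have "Q \<noteq> {}" using xstart by blast
  note * = Q \<open>Q \<noteq> {}\<close> quadratic_coeff_pos c
  show "z s k = closest_point Q ((- 1 / (1 + m * A k)) *\<^sub>R lin s k)"
    unfolding z_arg_min using * by (rule arg_min_on_quadratic)
  show "psi s k (z s k) + (1 + m * A k) / 2 * (norm (y - z s k))\<^sup>2 \<le> psi s k y" if "y \<in> Q"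
    unfolding z_arg_min using * that by (rule arg_min_on_quadratic_growth)
qed

lemma z_in: "z s k \<in> Q"
  unfolding z_eq using Q xstart by (intro closest_point_in_set) auto

lemma weighted_average_in:
  assumes "u \<in> Q" "v \<in> Q"
  shows "(1 / A (Suc k)) *\<^sub>R (A k *\<^sub>R u + \<alpha> (Suc k) *\<^sub>R v) \<in> Q"
proof -
  have "A (Suc k) > 0" by (rule A_pos)
  moreover have "A k / A (Suc k) + \<alpha> (Suc k) / A (Suc k) = 1"
    using A_pos[of "Suc k"] unfolding add_divide_distrib[symmetric] A_Suc[symmetric]
    by (simp del: stm_A.simps)
  ultimately have "(A k / A (Suc k)) *\<^sub>R u + (\<alpha> (Suc k) / A (Suc k)) *\<^sub>R v \<in> Q"
    using assms Q(2) A_pos[of k] \<alpha>_pos[of "Suc k"]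
    by (intro convexD) (auto simp del: stm_A.simps stm_alpha.simps)
  then show ?thesis by (simp add: scaleR_add_right del: stm_A.simps)
qed

lemma x_in: "x s k \<in> Q"
proof (induction k)
  case 0
  show ?case unfolding x_0 by (rule z_in)
next
  case (Suc k)
  show ?case unfolding x_Suc using Suc z_in by (rule weighted_average_in)
qed

lemma xt_in: "xt s k \<in> Q"
proof (cases k)
  case 0
  then show ?thesis using xstart by (simp add: xt_0)
next
  case (Suc j)
  show ?thesis unfolding Suc xt_Suc using x_in z_in by (rule weighted_average_in)
qed

section \<open>One-step inequalities for the potential\<close>

lemma upper: "u \<in> Q \<Longrightarrow> v \<in> Q \<Longrightarrow> f v \<le> f u + inner (grad u) (v - u) + L / 4 * (norm (v - u))\<^sup>2"
  using smooth_upper_bound[OF Q(2) deriv smooth, of u v] by simp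

text \<open>Since \<alpha>_0 = A_0 = 1 / L, the weighted smoothness term has coefficient 1/4. It
  takes half of the term 1/2 |z_0 - xstart|^2 in psi_0 and leaves the other half.\<close>

lemma gap_0:
  "gap s 0 \<le> (norm (xstart - xstar))\<^sup>2 / 2 + \<alpha> 0 * inner (err s 0) (xstar - z s 0)
     - (norm (z s 0 - xstart))\<^sup>2 / 4 - \<alpha> 0 * (\<mu> - m) / 2 * (norm (xstar - xstart))\<^sup>2"
proof -
  define z0 where "z0 = z s 0"
  define g where "g = G xstart (s 0)"
  define e where "e = err s 0"
  define D where "D = (norm (z0 - xstart))\<^sup>2"
  define r where "r = (norm (xstar - xstart))\<^sup>2"
  have e: "inner g w = inner (grad xstart) w + inner e w" for w
    unfolding e_def err_def g_def xt_0 by (simp add: inner_diff_left)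
  have "f z0 \<le> f xstart + inner (grad xstart) (z0 - xstart) + L / 4 * D"
    unfolding z0_def D_def by (intro upper xstart z_in)
  moreover have "f xstart + inner (grad xstart) (xstar - xstart) + \<mu> / 2 * r \<le> f xstar"
    using strongly_convex[OF xstart xstar(1)] by (simp add: r_def norm_minus_commute)
  moreover have "m / 2 * D \<ge> 0" unfolding D_def using m by simp
  ultimately have "f z0 - (inner g (z0 - xstart) + m / 2 * D) - L / 4 * D
      + (inner g (xstar - xstart) + m / 2 * r) - f xstar
      \<le> inner e (xstar - z0) - (\<mu> - m) / 2 * r"
    unfolding e by (simp add: inner_diff_right left_diff_distrib diff_divide_distrib)
  then have "(f z0 - (inner g (z0 - xstart) + m / 2 * D) - L / 4 * D
      + (inner g (xstar - xstart) + m / 2 * r) - f xstar) / L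
      \<le> (inner e (xstar - z0) - (\<mu> - m) / 2 * r) / L"
    using L by (intro divide_right_mono) auto
  moreover have "(L / 4 * D) / L = D / 4" using L by simp
  moreover have "gap s 0 = r / 2 - D / 2 + (f z0 - (inner g (z0 - xstart) + m / 2 * D)
      + (inner g (xstar - xstart) + m / 2 * r) - f xstar) / L"
    unfolding gap_def x_0 psi_0 stm_model_def z0_def[symmetric] g_def[symmetric] D_def r_def
    by (simp add: add_divide_distrib diff_divide_distrib algebra_simps)
  ultimately have "gap s 0 \<le> r / 2 - D / 4 + (inner e (xstar - z0) - (\<mu> - m) / 2 * r) / L"
    by (simp add: diff_divide_distrib add_divide_distrib)
  then show ?thesis
    by (simp add: e_def z0_def D_def r_def norm_minus_commute diff_divide_distrib add_divide_distrib
        algebra_simps)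
qed

text \<open>The two averages differ only in their last point, the old against the new minimiser. The
  second identity trades xt - z_k with weight \<alpha> for x_k - xt with weight A_k; it is how
  errors against z_k become errors against x_k.\<close>

lemma x_diff: "A (Suc k) *\<^sub>R (x s (Suc k) - xt s (Suc k)) = \<alpha> (Suc k) *\<^sub>R (z s (Suc k) - z s k)"
  and xt_balance: "A k *\<^sub>R (x s k - xt s (Suc k)) = \<alpha> (Suc k) *\<^sub>R (xt s (Suc k) - z s k)"
proof -
  have *: "A (Suc k) *\<^sub>R (1 / A (Suc k)) *\<^sub>R v = v" for v :: 'a
    using A_pos[of "Suc k"] by (simp del: stm_A.simps)
  show "A (Suc k) *\<^sub>R (x s (Suc k) - xt s (Suc k)) = \<alpha> (Suc k) *\<^sub>R (z s (Suc k) - z s k)"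
    unfolding scaleR_diff_right xt_Suc x_Suc * by simp
  have "A (Suc k) *\<^sub>R xt s (Suc k) = A k *\<^sub>R x s k + \<alpha> (Suc k) *\<^sub>R z s k"
    unfolding xt_Suc * by simp
  then show "A k *\<^sub>R (x s k - xt s (Suc k)) = \<alpha> (Suc k) *\<^sub>R (xt s (Suc k) - z s k)"
    unfolding A_Suc scaleR_add_left scaleR_diff_right by (simp add: algebra_simps)
qed

lemma gap_Suc:
  "gap s (Suc k) \<le> gap s k + \<alpha> (Suc k) * inner (err s (Suc k)) (xstar - z s (Suc k))
     - (1 + m * A k) / 4 * (norm (z s (Suc k) - z s k))\<^sup>2
     - A k * \<mu> / 2 * (norm (x s k - xt s (Suc k)))\<^sup>2
     - \<alpha> (Suc k) * (\<mu> - m) / 2 * (norm (xstar - xt s (Suc k)))\<^sup>2"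
proof -
  define a where "a = \<alpha> (Suc k)"
  define B where "B = A k"
  define B' where "B' = A (Suc k)"
  define p where "p = xt s (Suc k)"
  define z' where "z' = z s (Suc k)"
  define x' where "x' = x s (Suc k)"
  define g where "g = G p (s (Suc k))"
  define e where "e = err s (Suc k)"
  define D where "D = (norm (z' - z s k))\<^sup>2"
  define H where "H = (norm (x s k - p))\<^sup>2"
  define r where "r = (norm (xstar - p))\<^sup>2"
  have pos: "a > 0" "B > 0" "B' > 0" and B': "B' = B + a"
    unfolding a_def B_def B'_def by (rule \<alpha>_pos A_pos A_Suc)+
  have inQ: "p \<in> Q" "z' \<in> Q" "x' \<in> Q"
    unfolding p_def z'_def x'_def by (rule xt_in z_in x_in)+
  have e: "inner g w = inner (grad p) w + inner e w" for w
    unfolding e_def err_def g_def p_def by (simp add: inner_diff_left)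
  have x'p: "B' *\<^sub>R (x' - p) = B *\<^sub>R (x s k - p) + a *\<^sub>R (z' - p)"
  proof -
    have "B' *\<^sub>R (x' - p) = a *\<^sub>R (z' - z s k)"
      unfolding B'_def x'_def p_def a_def z'_def by (rule x_diff)
    also have "\<dots> = a *\<^sub>R (p - z s k) + a *\<^sub>R (z' - p)"
      by (simp add: scaleR_add_right[symmetric])
    also have "a *\<^sub>R (p - z s k) = B *\<^sub>R (x s k - p)"
      unfolding B_def p_def a_def by (rule xt_balance[symmetric])
    finally show ?thesis .
  qed
  \<comment> \<open>Here the defining equation of the step size enters: it converts the squared move
    of the output, weighted by L and B', into the squared move of the minimiser, weighted by the
    curvature of psi_k.\<close>
  have "norm (B' *\<^sub>R (x' - p)) = norm (a *\<^sub>R (z' - z s k))"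
    unfolding B'_def x'_def p_def a_def z'_def by (simp only: x_diff)
  then have "B' * norm (x' - p) = a * norm (z' - z s k)" using pos by simp
  then have "B'\<^sup>2 * (norm (x' - p))\<^sup>2 = a\<^sup>2 * D"
    unfolding D_def by (metis power_mult_distrib)
  then have "B' * (L * (B' * (norm (x' - p))\<^sup>2)) = (L * a\<^sup>2) * D"
    by (simp add: power2_eq_square)
  also have "\<dots> = B' * ((1 + m * B) * D)"
    using A_root[of k] unfolding a_def[symmetric] B_def[symmetric] B'_def[symmetric] by (metis mult.commute mult.assoc)
  finally have D: "L * (B' * (norm (x' - p))\<^sup>2) = (1 + m * B) * D"
    using pos by simp
  \<comment> \<open>The gradient term at the new output splits by \<open>x'p\<close>: the part
    towards the old output is bounded by strong convexity in 2, the part towards z' cancels against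
    the new model in psi.\<close>
  have "B' * f x' \<le> B' * (f p + inner (grad p) (x' - p) + L / 4 * (norm (x' - p))\<^sup>2)"
    using pos by (intro mult_left_mono upper inQ) auto
  also have "\<dots> = B' * f p + inner (grad p) (B' *\<^sub>R (x' - p)) + (L * (B' * (norm (x' - p))\<^sup>2)) / 4"
    by (simp add: algebra_simps)
  finally have 1: "B' * f x' \<le> B' * f p + B * inner (grad p) (x s k - p) + a * inner (grad p) (z' - p)
      + (1 + m * B) / 4 * D"
    unfolding D x'p by (simp add: inner_add_right)
  have "B * (f p + inner (grad p) (x s k - p) + \<mu> / 2 * H) \<le> B * f (x s k)"
    using pos strongly_convex[OF inQ(1) x_in[of s k]]
    by (intro mult_left_mono) (auto simp: H_def norm_minus_commute)
  then have 2: "B * f p + B * inner (grad p) (x s k - p) \<le> B * f (x s k) - B * \<mu> / 2 * H"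
    by (simp add: algebra_simps)
  have "a * (f p + inner (grad p) (xstar - p) + \<mu> / 2 * r) \<le> a * f xstar"
    using pos strongly_convex[OF inQ(1) xstar(1)]
    by (intro mult_left_mono) (auto simp: r_def norm_minus_commute)
  then have 3: "a * (f p + inner g (xstar - p) + m / 2 * r)
      \<le> a * f xstar + a * inner e (xstar - p) - a * (\<mu> - m) / 2 * r"
    unfolding e by (simp add: field_simps)
  have 4: "psi s (Suc k) xstar = psi s k xstar + a * (f p + inner g (xstar - p) + m / 2 * r)"
    unfolding psi_Suc stm_model_def a_def p_def g_def r_def by simp
  have "psi s (Suc k) z' = psi s k z' + a * (f p + inner g (z' - p) + m / 2 * (norm (z' - p))\<^sup>2)"
    unfolding psi_Suc stm_model_def a_def p_def g_def by simp
  moreover have "psi s k (z s k) + (1 + m * B) / 2 * D \<le> psi s k z'"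
    unfolding B_def D_def by (rule psi_growth[OF inQ(2)])
  moreover have "a * (m / 2 * (norm (z' - p))\<^sup>2) \<ge> 0" using pos m by simp
  ultimately have 5: "psi s k (z s k) + (1 + m * B) / 2 * D
      + (a * f p + a * inner (grad p) (z' - p) + a * inner e (z' - p)) \<le> psi s (Suc k) z'"
    unfolding e by (simp add: distrib_left)
  \<comment> \<open>Half of the growth of psi_k pays for the smoothness term in 1; the other half
    survives in the conclusion.\<close>
  have "(1 + m * B) / 2 * D = (1 + m * B) / 4 * D + (1 + m * B) / 4 * D" by simp
  moreover have "a * inner e (xstar - p) - a * inner e (z' - p) = a * inner e (xstar - z')"
    by (simp add: inner_diff_right algebra_simps)
  moreover have "gap s (Suc k) = B' * f x' - B' * f xstar - psi s (Suc k) z' + psi s (Suc k) xstar"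
    unfolding gap_def B'_def x'_def z'_def by (simp add: right_diff_distrib del: stm_A.simps)
  moreover have "gap s k = B * f (x s k) - B * f xstar - psi s k (z s k) + psi s k xstar"
    unfolding gap_def B_def by (simp add: right_diff_distrib)
  moreover have "B' * f p = B * f p + a * f p" "B' * f xstar = B * f xstar + a * f xstar"
    unfolding B' by (simp_all add: distrib_right)
  ultimately have "gap s (Suc k) \<le> gap s k + a * inner e (xstar - z') - (1 + m * B) / 4 * D
     - B * \<mu> / 2 * H - a * (\<mu> - m) / 2 * r"
    using 1 2 3 4 5 by linarith
  then show ?thesis unfolding a_def B_def p_def z'_def e_def D_def H_def r_def .
qed

lemma gap_ge:
  "A k * (f (x s k) - f xstar) + (1 + m * A k) / 2 * (norm (xstar - z s k))\<^sup>2 \<le> gap s k"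
  unfolding gap_def using psi_growth[OF xstar(1), of s k] by simp

text \<open>The centre \<open>xstart\<close> of psi_0 takes the part that the previous minimiser has
  in later steps; being deterministic, it is unaffected by the first sample.\<close>

lemma gap_0_le:
  "gap s 0 \<le> (norm (xstart - xstar))\<^sup>2 / 2 + \<alpha> 0 * norm (err s 0) * norm (xstart - xstar)
     + A 0 / L * (norm (err s 0))\<^sup>2"
proof -
  define e where "e = err s 0"
  define d where "d = norm (z s 0 - xstart)"
  have "inner e (xstar - z s 0) = inner e (xstar - xstart) - inner e (z s 0 - xstart)"
    by (simp add: inner_diff_right)
  moreover have "inner e (xstar - xstart) \<le> norm e * norm (xstart - xstar)"
    using norm_cauchy_schwarz[of e "xstar - xstart"] by (simp add: norm_minus_commute)
  moreover have "- inner e (z s 0 - xstart) \<le> norm e * d"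
    using Cauchy_Schwarz_ineq2[of e "z s 0 - xstart"] by (simp add: d_def)
  ultimately have "\<alpha> 0 * inner e (xstar - z s 0) \<le> \<alpha> 0 * (norm e * norm (xstart - xstar) + norm e * d)"
    using \<alpha>_pos[of 0] by (intro mult_left_mono) auto
  also have "\<dots> = \<alpha> 0 * norm e * norm (xstart - xstar) + (\<alpha> 0 * norm e) * d"
    by (simp add: distrib_left)
  also have "(\<alpha> 0 * norm e) * d \<le> (\<alpha> 0 * norm e)\<^sup>2 / 1 + 1 / 4 * d\<^sup>2"
    by (rule young_le) simp
  also have "(\<alpha> 0 * norm e)\<^sup>2 / 1 = A 0 / L * (norm e)\<^sup>2"
    by (simp add: power2_eq_square)
  finally have "\<alpha> 0 * inner e (xstar - z s 0)
     \<le> \<alpha> 0 * norm e * norm (xstart - xstar) + (A 0 / L * (norm e)\<^sup>2 + 1 / 4 * d\<^sup>2)" by simp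
  moreover have "\<alpha> 0 * (\<mu> - m) / 2 * (norm (xstar - xstart))\<^sup>2 \<ge> 0"
    using \<alpha>_pos[of 0] m by (intro mult_nonneg_nonneg divide_nonneg_nonneg) auto
  ultimately show ?thesis using gap_0[of s] unfolding e_def d_def by linarith
qed

lemma step_young:
  "(\<alpha> (Suc k) * norm e) * d \<le> A (Suc k) / L * (norm (e::'a))\<^sup>2 + (1 + m * A k) / 4 * d\<^sup>2"
proof -
  have "(\<alpha> (Suc k))\<^sup>2 / (1 + m * A k) = A (Suc k) / L"
    using A_root[of k] quadratic_coeff_pos[of k] L
    by (simp add: frac_eq_eq mult.commute del: stm_A.simps stm_alpha.simps)
  then have "(\<alpha> (Suc k) * norm e)\<^sup>2 / (1 + m * A k) = A (Suc k) / L * (norm e)\<^sup>2"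
    unfolding power_mult_distrib by (metis times_divide_eq_left)
  then show ?thesis
    using young_le[OF quadratic_coeff_pos[of k], of "\<alpha> (Suc k) * norm e" d] by simp
qed

lemma gap_Suc_le:
  "gap s (Suc k) \<le> gap s k + \<alpha> (Suc k) * norm (err s (Suc k)) * norm (z s k - xstar)
     + A (Suc k) / L * (norm (err s (Suc k)))\<^sup>2"
proof -
  define e where "e = err s (Suc k)"
  define a where "a = \<alpha> (Suc k)"
  define d where "d = norm (z s (Suc k) - z s k)"
  have a: "a > 0" unfolding a_def by (rule \<alpha>_pos)
  have "inner e (xstar - z s (Suc k)) = inner e (xstar - z s k) - inner e (z s (Suc k) - z s k)"
    by (simp add: inner_diff_right)
  moreover have "inner e (xstar - z s k) \<le> norm e * norm (z s k - xstar)"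
    using norm_cauchy_schwarz[of e "xstar - z s k"] by (simp add: norm_minus_commute)
  moreover have "- inner e (z s (Suc k) - z s k) \<le> norm e * d"
    using Cauchy_Schwarz_ineq2[of e "z s (Suc k) - z s k"] by (simp add: d_def)
  ultimately have "a * inner e (xstar - z s (Suc k)) \<le> a * (norm e * norm (z s k - xstar) + norm e * d)"
    using a by (intro mult_left_mono) auto
  also have "\<dots> = a * norm e * norm (z s k - xstar) + (a * norm e) * d"
    by (simp add: distrib_left)
  also have "(a * norm e) * d \<le> A (Suc k) / L * (norm e)\<^sup>2 + (1 + m * A k) / 4 * d\<^sup>2"
    unfolding a_def by (rule step_young)
  finally have "a * inner e (xstar - z s (Suc k)) \<le> a * norm e * norm (z s k - xstar)
      + (A (Suc k) / L * (norm e)\<^sup>2 + (1 + m * A k) / 4 * d\<^sup>2)" by simp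
  moreover have "A k * \<mu> / 2 * (norm (x s k - xt s (Suc k)))\<^sup>2 \<ge> 0"
    using A_pos[of k] m by (intro mult_nonneg_nonneg divide_nonneg_nonneg) auto
  moreover have "a * (\<mu> - m) / 2 * (norm (xstar - xt s (Suc k)))\<^sup>2 \<ge> 0"
    using a m by (intro mult_nonneg_nonneg divide_nonneg_nonneg) auto
  ultimately show ?thesis using gap_Suc[of s k] unfolding e_def d_def a_def by linarith
qed

lemma inner_young:
  assumes "\<mu> > 0"
  shows "inner (e::'a) w \<le> (norm e)\<^sup>2 / \<mu> + \<mu> / 4 * (norm w)\<^sup>2"
  using norm_cauchy_schwarz[of e w] young_le[OF assms, of "norm e" "norm w"] by linarith

text \<open>The first query point is \<open>xstart\<close> itself, so besides the move to z_0 only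
  xstar - xstart is paired with the error. With m = \<mu>/2 the available curvature (\<mu> - m) / 2
  = \<mu>/4 is exactly what \<open>inner_young\<close> consumes.\<close>

lemma gap_0_le_half:
  assumes half: "m = \<mu> / 2" "\<mu> > 0"
  shows "gap s 0 \<le> (norm (xstart - xstar))\<^sup>2 / 2 + A 0 * (1 / L + 1 / \<mu>) * (norm (err s 0))\<^sup>2"
proof -
  define e where "e = err s 0"
  define d where "d = norm (z s 0 - xstart)"
  define r where "r = (norm (xstar - xstart))\<^sup>2"
  have "inner e (xstar - z s 0) = inner e (xstar - xstart) - inner e (z s 0 - xstart)"
    by (simp add: inner_diff_right)
  moreover have "inner e (xstar - xstart) \<le> (norm e)\<^sup>2 / \<mu> + \<mu> / 4 * r"
    unfolding r_def by (rule inner_young[OF half(2)])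
  moreover have "- inner e (z s 0 - xstart) \<le> norm e * d"
    using Cauchy_Schwarz_ineq2[of e "z s 0 - xstart"] by (simp add: d_def)
  ultimately have "\<alpha> 0 * inner e (xstar - z s 0) \<le> \<alpha> 0 * (((norm e)\<^sup>2 / \<mu> + \<mu> / 4 * r) + norm e * d)"
    using \<alpha>_pos[of 0] by (intro mult_left_mono) auto
  also have "\<dots> = \<alpha> 0 * ((norm e)\<^sup>2 / \<mu> + \<mu> / 4 * r) + (\<alpha> 0 * norm e) * d"
    by (simp add: distrib_left)
  also have "(\<alpha> 0 * norm e) * d \<le> (\<alpha> 0 * norm e)\<^sup>2 / 1 + 1 / 4 * d\<^sup>2"
    by (rule young_le) simp
  also have "(\<alpha> 0 * norm e)\<^sup>2 / 1 = A 0 / L * (norm e)\<^sup>2"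
    by (simp add: power2_eq_square)
  finally have "\<alpha> 0 * inner e (xstar - z s 0)
     \<le> \<alpha> 0 * ((norm e)\<^sup>2 / \<mu> + \<mu> / 4 * r) + (A 0 / L * (norm e)\<^sup>2 + 1 / 4 * d\<^sup>2)" by simp
  moreover have "\<alpha> 0 * (\<mu> - m) / 2 * r = \<alpha> 0 * (\<mu> / 4 * r)"
    unfolding half(1) by (simp add: field_simps)
  moreover have "A 0 * (1 / L + 1 / \<mu>) * (norm e)\<^sup>2 = A 0 / L * (norm e)\<^sup>2 + \<alpha> 0 * ((norm e)\<^sup>2 / \<mu>)"
    by (simp add: algebra_simps)
  ultimately show ?thesis using gap_0[of s] unfolding e_def d_def r_def
    by (simp only: distrib_left norm_minus_commute[of xstart xstar])
qed

text \<open>The error is paired with three displacements: from the query point to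
  \<open>xstar\<close>, from z_k to the query point, and from z_k to z_(k+1).
  \<open>xt_balance\<close> turns the second into a displacement towards x_k, where strong convexity
  supplies curvature. No product of the error with a distance to \<open>xstar\<close> remains, and
  the weights \<alpha> and A_k of |e|^2 / \<mu> add up to A_(k+1).\<close>

lemma gap_Suc_le_half:
  assumes half: "m = \<mu> / 2" "\<mu> > 0"
  shows "gap s (Suc k) \<le> gap s k + A (Suc k) * (1 / L + 1 / \<mu>) * (norm (err s (Suc k)))\<^sup>2"
proof -
  define e where "e = err s (Suc k)"
  define a where "a = \<alpha> (Suc k)"
  define p where "p = xt s (Suc k)"
  define d where "d = norm (z s (Suc k) - z s k)"
  define E where "E = (norm e)\<^sup>2 / \<mu>"
  define H where "H = \<mu> / 4 * (norm (x s k - p))\<^sup>2"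
  define r where "r = \<mu> / 4 * (norm (xstar - p))\<^sup>2"
  have a: "a > 0" unfolding a_def by (rule \<alpha>_pos)
  have "a * inner e (p - z s k) = inner e (a *\<^sub>R (p - z s k))" by simp
  also have "\<dots> = inner e (A k *\<^sub>R (x s k - p))" unfolding a_def p_def by (simp only: xt_balance)
  also have "\<dots> = A k * inner e (x s k - p)" by simp
  also have "\<dots> \<le> A k * (E + H)"
    unfolding E_def H_def using A_pos[of k] by (intro mult_left_mono inner_young half) auto
  finally have 1: "a * inner e (p - z s k) \<le> A k * E + A k * H" by (simp add: distrib_left)
  have "a * inner e (xstar - p) \<le> a * (E + r)"
    unfolding E_def r_def using a by (intro mult_left_mono inner_young half) auto
  then have 2: "a * inner e (xstar - p) \<le> a * E + a * r" by (simp add: distrib_left)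
  have "- inner e (z s (Suc k) - z s k) \<le> norm e * d"
    using Cauchy_Schwarz_ineq2[of e "z s (Suc k) - z s k"] by (simp add: d_def)
  then have "a * - inner e (z s (Suc k) - z s k) \<le> a * (norm e * d)"
    using a by (intro mult_left_mono) auto
  also have "\<dots> = (a * norm e) * d" by simp
  also have "\<dots> \<le> A (Suc k) / L * (norm e)\<^sup>2 + (1 + m * A k) / 4 * d\<^sup>2"
    unfolding a_def by (rule step_young)
  finally have 3: "- (a * inner e (z s (Suc k) - z s k))
      \<le> A (Suc k) / L * (norm e)\<^sup>2 + (1 + m * A k) / 4 * d\<^sup>2" by simp
  have 4: "a * inner e (xstar - z s (Suc k)) = a * inner e (xstar - p) + a * inner e (p - z s k)
      - a * inner e (z s (Suc k) - z s k)"
    by (simp add: inner_diff_right algebra_simps)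
  have 5: "A (Suc k) * (1 / L + 1 / \<mu>) * (norm e)\<^sup>2 = A (Suc k) / L * (norm e)\<^sup>2 + (A k * E + a * E)"
    unfolding E_def a_def distrib_right[symmetric] A_Suc[symmetric]
    by (simp add: algebra_simps del: stm_A.simps)
  \<comment> \<open>Curvature offered against curvature spent: twice as much at x_k, exactly as much
    at \<open>xstar\<close>.\<close>
  have 6: "A k * \<mu> / 2 * (norm (x s k - p))\<^sup>2 = 2 * (A k * H)" "a * (\<mu> - m) / 2 * (norm (xstar - p))\<^sup>2 = a * r"
    unfolding H_def r_def half by simp_all
  have 7: "0 \<le> A k * H" unfolding H_def using A_pos[of k] half(2) by (intro mult_nonneg_nonneg) auto
  have "gap s (Suc k) \<le> gap s k + a * inner e (xstar - z s (Suc k)) - (1 + m * A k) / 4 * d\<^sup>2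
     - A k * \<mu> / 2 * (norm (x s k - p))\<^sup>2 - a * (\<mu> - m) / 2 * (norm (xstar - p))\<^sup>2"
    unfolding a_def e_def d_def p_def by (rule gap_Suc)
  then show ?thesis using 1 2 3 4 5 6 7 unfolding e_def[symmetric] by linarith
qed

end

section \<open>Independence and integrability\<close>

text \<open>The joint law is a product, so \<open>Y\<close> can be integrated out with
  \<open>X\<close> frozen. Working with nonnegative integrals lets integrability of the mixed terms
  be a conclusion instead of a prerequisite.\<close>

lemma (in prob_space) nn_integral_indep_le:
  assumes indep: "indep_var N X T Y"
    and h: "h \<in> borel_measurable (N \<Otimes>\<^sub>M T)" and c: "c \<in> borel_measurable N"
    and le: "\<And>u. u \<in> space N \<Longrightarrow> (\<integral>\<^sup>+\<omega>. h (u, Y \<omega>) \<partial>M) \<le> c u"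
  shows "(\<integral>\<^sup>+\<omega>. h (X \<omega>, Y \<omega>) \<partial>M) \<le> (\<integral>\<^sup>+\<omega>. c (X \<omega>) \<partial>M)"
proof -
  have X: "X \<in> measurable M N" and Y: "Y \<in> measurable M T"
    and joint: "distr M N X \<Otimes>\<^sub>M distr M T Y = distr M (N \<Otimes>\<^sub>M T) (\<lambda>\<omega>. (X \<omega>, Y \<omega>))"
    using indep unfolding indep_var_distribution_eq by auto
  interpret Y: prob_space "distr M T Y" using Y by (rule prob_space_distr)
  have h': "h \<in> borel_measurable (distr M N X \<Otimes>\<^sub>M distr M T Y)"
    using h by (simp cong: measurable_cong_sets)
  have "(\<integral>\<^sup>+\<omega>. h (X \<omega>, Y \<omega>) \<partial>M) = (\<integral>\<^sup>+p. h p \<partial>distr M (N \<Otimes>\<^sub>M T) (\<lambda>\<omega>. (X \<omega>, Y \<omega>)))"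
    using X Y h by (subst nn_integral_distr) auto
  also have "\<dots> = (\<integral>\<^sup>+u. \<integral>\<^sup>+t. h (u, t) \<partial>distr M T Y \<partial>distr M N X)"
    unfolding joint[symmetric] by (rule Y.nn_integral_fst[OF h', symmetric])
  also have "\<dots> \<le> (\<integral>\<^sup>+u. c u \<partial>distr M N X)"
  proof (rule nn_integral_mono)
    fix u assume "u \<in> space (distr M N X)"
    then have u: "u \<in> space N" by simp
    then have "(\<integral>\<^sup>+t. h (u, t) \<partial>distr M T Y) = (\<integral>\<^sup>+\<omega>. h (u, Y \<omega>) \<partial>M)"
      using Y measurable_compose_Pair1[OF _ h] by (intro nn_integral_distr) auto
    then show "(\<integral>\<^sup>+t. h (u, t) \<partial>distr M T Y) \<le> c u" using le[OF u] by simp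
  qed
  also have "\<dots> = (\<integral>\<^sup>+\<omega>. c (X \<omega>) \<partial>M)"
    using X c by (subst nn_integral_distr) auto
  finally show ?thesis .
qed

lemma stm_cong: "(\<And>i. i \<le> k \<Longrightarrow> s i = s' i) \<Longrightarrow> stm Q f G L m p s k = stm Q f G L m p s' k"
  by (induction k) (auto simp: Let_def)

text \<open>Off by one against \<open>stm_cong\<close>: the query point of iteration k is fixed
  before sample k is drawn. This is what lets the variance bound be applied at a random
  point.\<close>

lemma query_point_cong:
  "(\<And>i. i < k \<Longrightarrow> s i = s' i) \<Longrightarrow>
    query_point (stm Q f G L m p s k) = query_point (stm Q f G L m p s' k)"
proof (cases k)
  case (Suc j)
  assume "\<And>i. i < k \<Longrightarrow> s i = s' i"
  then have "stm Q f G L m p s j = stm Q f G L m p s' j"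
    by (intro stm_cong) (simp add: Suc)
  then show ?thesis by (simp add: Suc Let_def)
qed (simp add: Let_def)

text \<open>The variance bound is stated at fixed points of \<open>Q\<close>; at the random query
  points it is derived from the independence of the samples.\<close>

locale stm_stochastic = stm_problem Q f grad G xstart xstar L \<mu> m + prob_space M
  for Q :: "'a::euclidean_space set"
    and f :: "'a \<Rightarrow> real"
    and grad :: "'a \<Rightarrow> 'a"
    and G :: "'a \<Rightarrow> 's \<Rightarrow> 'a"
    and xstart xstar :: 'a
    and L \<mu> m :: real
    and M :: "'w measure" +
  fixes S :: "'s measure"
    and \<xi> :: "nat \<Rightarrow> 'w \<Rightarrow> 's"
    and \<delta> :: real
  assumes indep: "indep_vars (\<lambda>_. S) \<xi> UNIV"
    and G_measurable: "(\<lambda>(u, s). G u s) \<in> borel_measurable (restrict_space borel Q \<Otimes>\<^sub>M S)"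
    and delta: "\<delta> \<ge> 0"
    and variance: "\<And>k u. u \<in> Q \<Longrightarrow>
          (\<integral>\<^sup>+ \<omega>. ennreal ((norm (G u (\<xi> k \<omega>) - grad u))\<^sup>2) \<partial>M) \<le> ennreal (\<delta>\<^sup>2)"
begin

abbreviation "seq \<omega> \<equiv> (\<lambda>i. \<xi> i \<omega>)"

lemma xi_measurable [measurable]: "\<xi> k \<in> measurable M S"
  using indep unfolding indep_vars_def by auto

text \<open>\<open>G\<close> is known to be measurable only over \<open>Q\<close>, so the inserted
  point must lie in \<open>Q\<close> everywhere on the space, not just almost everywhere.\<close>

lemma G_compose:
  assumes "u \<in> borel_measurable N" "\<And>w. w \<in> space N \<Longrightarrow> u w \<in> Q" "t \<in> measurable N S"
  shows "(\<lambda>w. G (u w) (t w)) \<in> borel_measurable N"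
proof -
  have "u \<in> measurable N (restrict_space borel Q)"
    using assms by (intro measurable_restrict_space2) auto
  then have "(\<lambda>w. (u w, t w)) \<in> measurable N (restrict_space borel Q \<Otimes>\<^sub>M S)"
    using assms(3) by (rule measurable_Pair)
  from measurable_compose[OF this G_measurable] show ?thesis by simp
qed

lemma continuous_compose:
  fixes h :: "'a \<Rightarrow> 'b::topological_space"
  assumes "continuous_on Q h" "u \<in> borel_measurable N" "\<And>w. w \<in> space N \<Longrightarrow> u w \<in> Q"
  shows "(\<lambda>w. h (u w)) \<in> borel_measurable N"
proof -
  have "u \<in> measurable N (restrict_space borel Q)"
    using assms by (intro measurable_restrict_space2) auto
  from measurable_compose[OF this borel_measurable_continuous_on_restrict[OF assms(1)]]
  show ?thesis .
qed

lemma grad_continuous: "continuous_on Q grad"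
proof -
  have "(L / 2)-lipschitz_on Q grad"
    using smooth L by (intro lipschitz_onI) (auto simp: dist_norm)
  then show ?thesis by (rule lipschitz_on_continuous_on)
qed

lemma f_continuous: "continuous_on Q f"
  using deriv by (meson continuous_on_eq_continuous_within has_derivative_continuous)

text \<open>The index set is left free: \<open>{..<k}\<close> expresses dependence on the past
  alone, as independence requires, and \<open>UNIV\<close> yields random variables on
  \<open>M\<close>. The induction is strong because \<open>lin s k\<close> collects all earlier
  query points.\<close>

lemma state_measurable:
  "{..<k} \<subseteq> I \<Longrightarrow> (\<lambda>s. xt s k) \<in> borel_measurable (PiM I (\<lambda>_. S))"
  "{..k} \<subseteq> I \<Longrightarrow> (\<lambda>s. lin s k) \<in> borel_measurable (PiM I (\<lambda>_. S))"
  "{..k} \<subseteq> I \<Longrightarrow> (\<lambda>s. z s k) \<in> borel_measurable (PiM I (\<lambda>_. S))"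
  "{..k} \<subseteq> I \<Longrightarrow> (\<lambda>s. x s k) \<in> borel_measurable (PiM I (\<lambda>_. S))"
proof (induction k rule: less_induct)
  case (less k)
  have xt: "(\<lambda>s. xt s k) \<in> borel_measurable (PiM I (\<lambda>_. S))" if "{..<k} \<subseteq> I"
  proof (cases k)
    case 0
    then show ?thesis by (simp add: xt_0)
  next
    case (Suc j)
    with that have j: "j < k" "{..j} \<subseteq> I" by auto
    show ?thesis unfolding Suc xt_Suc
      by (intro borel_measurable_scaleR borel_measurable_add borel_measurable_const less(3,4) j)
  qed
  have lin: "(\<lambda>s. lin s k) \<in> borel_measurable (PiM I (\<lambda>_. S))" if I: "{..k} \<subseteq> I"
    unfolding lin_def
  proof (intro borel_measurable_diff borel_measurable_sum borel_measurable_scaleR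
      borel_measurable_const G_compose xt_in)
    fix i assume "i \<in> {..k}"
    then show "(\<lambda>s. s i) \<in> measurable (PiM I (\<lambda>_. S)) S"
      using I by (intro measurable_component_singleton) auto
    have "{..<i} \<subseteq> I" using I \<open>i \<in> {..k}\<close> by auto
    then show "(\<lambda>s. xt s i) \<in> borel_measurable (PiM I (\<lambda>_. S))"
      using xt less(1)[of i] \<open>i \<in> {..k}\<close> by (cases "i = k") auto
    then show "(\<lambda>s. xt s i) \<in> borel_measurable (PiM I (\<lambda>_. S))" .
  qed
  have z: "(\<lambda>s. z s k) \<in> borel_measurable (PiM I (\<lambda>_. S))" if I: "{..k} \<subseteq> I"
  proof -
    have "closest_point Q \<in> borel_measurable borel"
      using Q xstart by (intro borel_measurable_continuous_onI continuous_on_closest_point) auto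
    then show ?thesis unfolding z_eq
      by (rule measurable_compose[rotated])
        (intro borel_measurable_scaleR borel_measurable_const lin[OF I])
  qed
  have x: "(\<lambda>s. x s k) \<in> borel_measurable (PiM I (\<lambda>_. S))" if I: "{..k} \<subseteq> I"
  proof (cases k)
    case 0
    with z[OF I] show ?thesis by (simp add: x_0)
  next
    case (Suc j)
    with I have j: "j < k" "{..j} \<subseteq> I" by auto
    show ?thesis unfolding Suc x_Suc
      by (intro borel_measurable_scaleR borel_measurable_add borel_measurable_const less(4) j
          z[OF I, unfolded Suc])
  qed
  show "{..<k} \<subseteq> I \<Longrightarrow> (\<lambda>s. xt s k) \<in> borel_measurable (PiM I (\<lambda>_. S))"
    "{..k} \<subseteq> I \<Longrightarrow> (\<lambda>s. lin s k) \<in> borel_measurable (PiM I (\<lambda>_. S))"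
    "{..k} \<subseteq> I \<Longrightarrow> (\<lambda>s. z s k) \<in> borel_measurable (PiM I (\<lambda>_. S))"
    "{..k} \<subseteq> I \<Longrightarrow> (\<lambda>s. x s k) \<in> borel_measurable (PiM I (\<lambda>_. S))"
    by (rule xt lin z x; assumption)+
qed

lemma seq_measurable: "seq \<in> measurable M (PiM UNIV (\<lambda>_. S))"
  using measurable_space[OF xi_measurable] by (intro measurable_PiM_single') auto

lemma state_random_variable [measurable]:
  "(\<lambda>\<omega>. xt (seq \<omega>) k) \<in> borel_measurable M"
  "(\<lambda>\<omega>. lin (seq \<omega>) k) \<in> borel_measurable M"
  "(\<lambda>\<omega>. z (seq \<omega>) k) \<in> borel_measurable M"
  "(\<lambda>\<omega>. x (seq \<omega>) k) \<in> borel_measurable M"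
  by (rule measurable_compose[OF seq_measurable] state_measurable subset_UNIV)+

lemma err_random_variable [measurable]: "(\<lambda>\<omega>. err (seq \<omega>) k) \<in> borel_measurable M"
  unfolding err_def
  by (intro borel_measurable_diff G_compose continuous_compose[OF grad_continuous]
      state_random_variable xi_measurable xt_in)

lemma indep_past:
  "indep_var (PiM {..<k} (\<lambda>_. S)) (\<lambda>\<omega>. restrict (seq \<omega>) {..<k})
     (PiM {k} (\<lambda>_. S)) (\<lambda>\<omega>. restrict (seq \<omega>) {k})"
  by (rule indep_var_restrict[OF indep]) auto

text \<open>With the past frozen, integrating out sample k bounds the \<phi>-moment of the error by
  \<open>c\<close>, and the weight \<open>V\<close>, a function of the past, factors out. The
  general \<phi> serves two uses: squares with V = 1, and absolute values with V a distance.\<close>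

lemma err_weighted:
  fixes \<phi> :: "real \<Rightarrow> real" and V :: "(nat \<Rightarrow> 's) \<Rightarrow> real"
  assumes \<phi>: "\<phi> \<in> borel_measurable borel" "\<And>t. 0 \<le> \<phi> t" and c: "c \<ge> 0"
    and le: "\<And>u. u \<in> Q \<Longrightarrow> (\<integral>\<^sup>+\<omega>. ennreal (\<phi> (norm (G u (\<xi> k \<omega>) - grad u))) \<partial>M) \<le> ennreal c"
    and V: "V \<in> borel_measurable (PiM {..<k} (\<lambda>_. S))" "\<And>s. 0 \<le> V s"
    and V_past: "\<And>s. V (restrict s {..<k}) = V s"
    and V_integrable: "integrable M (\<lambda>\<omega>. V (seq \<omega>))"
  shows "integrable M (\<lambda>\<omega>. \<phi> (norm (err (seq \<omega>) k)) * V (seq \<omega>))"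
    and "(\<integral>\<omega>. \<phi> (norm (err (seq \<omega>) k)) * V (seq \<omega>) \<partial>M) \<le> c * (\<integral>\<omega>. V (seq \<omega>) \<partial>M)"
proof -
  let ?P = "PiM {..<k} (\<lambda>_. S)" and ?N = "PiM {k} (\<lambda>_. S)"
  define h where "h = (\<lambda>(s, t). ennreal (\<phi> (norm (G (xt s k) (t k) - grad (xt s k))) * V s))"
  have xt: "(\<lambda>p. xt (fst p) k) \<in> borel_measurable (?P \<Otimes>\<^sub>M ?N)"
    by (rule measurable_compose[OF measurable_fst]) (simp add: state_measurable)
  have V': "(\<lambda>p. V (fst p)) \<in> borel_measurable (?P \<Otimes>\<^sub>M ?N)"
    by (rule measurable_compose[OF measurable_fst V(1)])
  have G': "(\<lambda>p. G (xt (fst p) k) (snd p k)) \<in> borel_measurable (?P \<Otimes>\<^sub>M ?N)"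
    by (rule G_compose[OF xt xt_in])
      (rule measurable_compose[OF measurable_snd], simp add: measurable_component_singleton)
  have grad': "(\<lambda>p. grad (xt (fst p) k)) \<in> borel_measurable (?P \<Otimes>\<^sub>M ?N)"
    by (rule continuous_compose[OF grad_continuous xt xt_in])
  have h: "h \<in> borel_measurable (?P \<Otimes>\<^sub>M ?N)"
    unfolding h_def case_prod_beta using G' grad' V' \<phi>(1) by measurable
  have xt_past: "xt (restrict s {..<k}) k = xt s k" for s
    by (rule query_point_cong) simp
  have "(\<integral>\<^sup>+\<omega>. ennreal (\<phi> (norm (err (seq \<omega>) k)) * V (seq \<omega>)) \<partial>M)
      = (\<integral>\<^sup>+\<omega>. h (restrict (seq \<omega>) {..<k}, restrict (seq \<omega>) {k}) \<partial>M)"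
    unfolding h_def prod.case xt_past V_past err_def by simp
  also have "\<dots> \<le> (\<integral>\<^sup>+\<omega>. ennreal (c * V (restrict (seq \<omega>) {..<k})) \<partial>M)"
  proof (rule nn_integral_indep_le[OF indep_past h])
    show "(\<lambda>s. ennreal (c * V s)) \<in> borel_measurable ?P" using V by measurable
    fix s
    have "(\<integral>\<^sup>+\<omega>. h (s, restrict (seq \<omega>) {k}) \<partial>M)
        = (\<integral>\<^sup>+\<omega>. ennreal (\<phi> (norm (G (xt s k) (\<xi> k \<omega>) - grad (xt s k)))) * ennreal (V s) \<partial>M)"
      unfolding h_def prod.case by (simp add: ennreal_mult \<phi> V)
    also have "\<dots> = (\<integral>\<^sup>+\<omega>. ennreal (\<phi> (norm (G (xt s k) (\<xi> k \<omega>) - grad (xt s k)))) \<partial>M) * ennreal (V s)"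
    proof (rule nn_integral_multc)
      have "(\<lambda>\<omega>. G (xt s k) (\<xi> k \<omega>)) \<in> borel_measurable M"
        by (intro G_compose xt_in) auto
      then show "(\<lambda>\<omega>. ennreal (\<phi> (norm (G (xt s k) (\<xi> k \<omega>) - grad (xt s k))))) \<in> borel_measurable M"
        using \<phi>(1) by measurable
    qed
    also have "\<dots> \<le> ennreal c * ennreal (V s)"
      by (intro mult_right_mono le xt_in) auto
    also have "\<dots> = ennreal (c * V s)" using c V by (simp add: ennreal_mult)
    finally show "(\<integral>\<^sup>+\<omega>. h (s, restrict (seq \<omega>) {k}) \<partial>M) \<le> ennreal (c * V s)" .
  qed
  also have "\<dots> = ennreal (c * (\<integral>\<omega>. V (seq \<omega>) \<partial>M))"
    unfolding V_past using V_integrable V(2) c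
    by (subst nn_integral_eq_integral) auto
  finally have *: "(\<integral>\<^sup>+\<omega>. ennreal (\<phi> (norm (err (seq \<omega>) k)) * V (seq \<omega>)) \<partial>M)
      \<le> ennreal (c * (\<integral>\<omega>. V (seq \<omega>) \<partial>M))" .
  have nonneg: "0 \<le> \<phi> (norm (err (seq \<omega>) k)) * V (seq \<omega>)" for \<omega>
    using \<phi> V by simp
  have meas: "(\<lambda>\<omega>. \<phi> (norm (err (seq \<omega>) k)) * V (seq \<omega>)) \<in> borel_measurable M"
    using borel_measurable_integrable[OF V_integrable] \<phi>(1) err_random_variable by measurable
  show int: "integrable M (\<lambda>\<omega>. \<phi> (norm (err (seq \<omega>) k)) * V (seq \<omega>))"
    by (rule integrableI_nonneg[OF meas]) (use nonneg * in \<open>auto simp: le_less_trans\<close>)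
  have "0 \<le> (\<integral>\<omega>. V (seq \<omega>) \<partial>M)" using V(2) by simp
  with * nn_integral_eq_integral[OF int] nonneg c
  show "(\<integral>\<omega>. \<phi> (norm (err (seq \<omega>) k)) * V (seq \<omega>) \<partial>M) \<le> c * (\<integral>\<omega>. V (seq \<omega>) \<partial>M)"
    by (simp add: ennreal_le_iff)
qed

text \<open>The variance of the error norm is nonnegative, so the square of its mean is at most its
  second moment.\<close>

lemma first_moment:
  assumes u: "u \<in> Q"
  shows "(\<integral>\<^sup>+\<omega>. ennreal (norm (G u (\<xi> k \<omega>) - grad u)) \<partial>M) \<le> ennreal \<delta>"
proof -
  define Y where "Y \<omega> = norm (G u (\<xi> k \<omega>) - grad u)" for \<omega>
  have Y: "Y \<in> borel_measurable M"
  proof -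
    have "(\<lambda>\<omega>. G u (\<xi> k \<omega>)) \<in> borel_measurable M"
      using u by (intro G_compose) auto
    then show ?thesis unfolding Y_def[abs_def] by measurable
  qed
  have var: "(\<integral>\<^sup>+\<omega>. ennreal ((Y \<omega>)\<^sup>2) \<partial>M) \<le> ennreal (\<delta>\<^sup>2)"
    unfolding Y_def by (rule variance[OF u])
  then have sq: "integrable M (\<lambda>\<omega>. (Y \<omega>)\<^sup>2)"
    using Y by (intro integrableI_nonneg) (auto simp: le_less_trans)
  with var have sq_le: "expectation (\<lambda>\<omega>. (Y \<omega>)\<^sup>2) \<le> \<delta>\<^sup>2"
    by (subst (asm) nn_integral_eq_integral) (auto simp: ennreal_le_iff)
  have int: "integrable M Y" using square_integrable_imp_integrable[OF Y sq] .
  have "(expectation Y)\<^sup>2 \<le> expectation (\<lambda>\<omega>. (Y \<omega>)\<^sup>2)"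
    using variance_eq[OF int sq] variance_positive[of Y] by simp
  then have "expectation Y \<le> \<delta>"
    using sq_le delta by (blast intro: power2_le_imp_le order_trans)
  moreover have "(\<integral>\<^sup>+\<omega>. ennreal (Y \<omega>) \<partial>M) = ennreal (expectation Y)"
    by (rule nn_integral_eq_integral[OF int]) (simp add: Y_def)
  ultimately show ?thesis unfolding Y_def by (simp add: ennreal_leI)
qed

lemma err_square:
  "integrable M (\<lambda>\<omega>. (norm (err (seq \<omega>) k))\<^sup>2)"
  "(\<integral>\<omega>. (norm (err (seq \<omega>) k))\<^sup>2 \<partial>M) \<le> \<delta>\<^sup>2"
proof -
  have sq: "(\<lambda>t::real. t\<^sup>2) \<in> borel_measurable borel" by measurable
  have *: "integrable M (\<lambda>\<omega>. (norm (err (seq \<omega>) k))\<^sup>2 * 1) \<and>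
      (\<integral>\<omega>. (norm (err (seq \<omega>) k))\<^sup>2 * 1 \<partial>M) \<le> \<delta>\<^sup>2 * (\<integral>\<omega>. 1 \<partial>M)"
    by (intro conjI err_weighted[OF sq zero_le_power2 zero_le_power2 variance, where V = "\<lambda>_. 1"])
      auto
  show "integrable M (\<lambda>\<omega>. (norm (err (seq \<omega>) k))\<^sup>2)" using * by simp
  show "(\<integral>\<omega>. (norm (err (seq \<omega>) k))\<^sup>2 \<partial>M) \<le> \<delta>\<^sup>2" using * by (simp add: prob_space)
qed

lemma err_mult_past:
  fixes V :: "(nat \<Rightarrow> 's) \<Rightarrow> real"
  assumes V: "V \<in> borel_measurable (PiM {..<k} (\<lambda>_. S))" "\<And>s. 0 \<le> V s"
    "\<And>s. V (restrict s {..<k}) = V s" "integrable M (\<lambda>\<omega>. V (seq \<omega>))"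
  shows "integrable M (\<lambda>\<omega>. norm (err (seq \<omega>) k) * V (seq \<omega>))"
    and "(\<integral>\<omega>. norm (err (seq \<omega>) k) * V (seq \<omega>) \<partial>M) \<le> \<delta> * (\<integral>\<omega>. V (seq \<omega>) \<partial>M)"
proof -
  \<comment> \<open>\<open>err_weighted\<close> wants \<phi> nonnegative on all reals, which the
    identity is not; the absolute value agrees with it on norms.\<close>
  have abs: "(\<lambda>t::real. \<bar>t\<bar>) \<in> borel_measurable borel" by measurable
  have le: "(\<integral>\<^sup>+\<omega>. ennreal \<bar>norm (G u (\<xi> k \<omega>) - grad u)\<bar> \<partial>M) \<le> ennreal \<delta>" if "u \<in> Q" for u
    unfolding abs_norm_cancel using that by (rule first_moment)
  show "integrable M (\<lambda>\<omega>. norm (err (seq \<omega>) k) * V (seq \<omega>))"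
    "(\<integral>\<omega>. norm (err (seq \<omega>) k) * V (seq \<omega>) \<partial>M) \<le> \<delta> * (\<integral>\<omega>. V (seq \<omega>) \<partial>M)"
    using err_weighted[OF abs abs_ge_zero delta le V] unfolding abs_norm_cancel by simp_all
qed

lemma err_integrable: "integrable M (\<lambda>\<omega>. err (seq \<omega>) k)"
proof -
  have "integrable M (\<lambda>\<omega>. norm (err (seq \<omega>) k) * 1)"
    by (rule err_mult_past(1)[where V = "\<lambda>_. 1"]) auto
  then show ?thesis by (simp add: integrable_norm_iff)
qed

lemma integrable_Lipschitz_compose:
  fixes h :: "'a \<Rightarrow> 'a"
  assumes "integrable M u" "(\<lambda>\<omega>. h (u \<omega>)) \<in> borel_measurable M"
    and le: "\<And>\<omega>. norm (h (u \<omega>) - b) \<le> K * norm (u \<omega> - a)"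
  shows "integrable M (\<lambda>\<omega>. h (u \<omega>))"
proof -
  have "integrable M (\<lambda>\<omega>. h (u \<omega>) - b)"
  proof (rule Bochner_Integration.integrable_bound)
    show "integrable M (\<lambda>\<omega>. K * norm (u \<omega> - a))" using assms(1) by simp
    show "AE \<omega> in M. norm (h (u \<omega>) - b) \<le> norm (K * norm (u \<omega> - a))"
      using order_trans[OF le abs_ge_self] by simp
  qed (use assms in simp)
  then have "integrable M (\<lambda>\<omega>. (h (u \<omega>) - b) + b)" by (intro Bochner_Integration.integrable_add) auto
  then show ?thesis by simp
qed

text \<open>Without this, expectations in \<open>stm_B\<close> could be the default value 0 of a
  divergent integral. First moments pass through the recursion: the error has one whatever the law
  of the query point, the gradient is Lipschitz, and the projection is nonexpansive and fixes
  \<open>xstar\<close>.\<close>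

lemma state_integrable:
  "integrable M (\<lambda>\<omega>. xt (seq \<omega>) k)" "integrable M (\<lambda>\<omega>. lin (seq \<omega>) k)"
  "integrable M (\<lambda>\<omega>. z (seq \<omega>) k)" "integrable M (\<lambda>\<omega>. x (seq \<omega>) k)"
proof (induction k rule: less_induct)
  case (less k)
  show xt: "integrable M (\<lambda>\<omega>. xt (seq \<omega>) k)"
  proof (cases k)
    case 0
    then show ?thesis by (simp add: xt_0)
  next
    case (Suc j)
    then have j: "j < k" by simp
    show ?thesis unfolding Suc xt_Suc
      by (intro integrable_scaleR_right Bochner_Integration.integrable_add less(3,4) j)
  qed
  have G: "integrable M (\<lambda>\<omega>. G (xt (seq \<omega>) i) (\<xi> i \<omega>))" if "integrable M (\<lambda>\<omega>. xt (seq \<omega>) i)" for i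
  proof -
    have "integrable M (\<lambda>\<omega>. grad (xt (seq \<omega>) i))"
      by (rule integrable_Lipschitz_compose[OF that, where a = xstar and K = "L / 2" and b = "grad xstar"])
        (intro smooth xt_in xstar(1) continuous_compose[OF grad_continuous] state_random_variable)+
    then have "integrable M (\<lambda>\<omega>. err (seq \<omega>) i + grad (xt (seq \<omega>) i))"
      by (intro Bochner_Integration.integrable_add err_integrable)
    then show ?thesis by (simp add: err_def)
  qed
  have xt': "integrable M (\<lambda>\<omega>. xt (seq \<omega>) i)" if "i \<le> k" for i
    using that xt less(1)[of i] by (cases "i = k") (simp, metis le_neq_implies_less)
  show lin: "integrable M (\<lambda>\<omega>. lin (seq \<omega>) k)"
    unfolding lin_def
  proof (intro Bochner_Integration.integrable_diff Bochner_Integration.integrable_sum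
        integrable_scaleR_right integrable_const)
    fix i assume "i \<in> {..k}"
    then have "integrable M (\<lambda>\<omega>. xt (seq \<omega>) i)" by (intro xt') simp
    then show "integrable M (\<lambda>\<omega>. G (xt (seq \<omega>) i) (\<xi> i \<omega>))"
      "integrable M (\<lambda>\<omega>. xt (seq \<omega>) i)" by (rule G, assumption)
  qed
  show z: "integrable M (\<lambda>\<omega>. z (seq \<omega>) k)"
    unfolding z_eq
  proof (rule integrable_Lipschitz_compose[where h = "closest_point Q" and K = 1
        and a = xstar and b = xstar])
    show "integrable M (\<lambda>\<omega>. (- 1 / (1 + m * A k)) *\<^sub>R lin (seq \<omega>) k)"
      by (rule integrable_scaleR_right) (rule lin)
    show "(\<lambda>\<omega>. closest_point Q ((- 1 / (1 + m * A k)) *\<^sub>R lin (seq \<omega>) k)) \<in> borel_measurable M"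
      unfolding z_eq[symmetric] by (rule state_random_variable)
    show "norm (closest_point Q y - xstar) \<le> 1 * norm (y - xstar)" for y
      using closest_point_lipschitz[OF Q(2,1), of y xstar] closest_point_self[OF xstar(1)] xstar(1)
      by (auto simp: dist_norm)
  qed
  show "integrable M (\<lambda>\<omega>. x (seq \<omega>) k)"
  proof (cases k)
    case 0
    with z show ?thesis by (simp add: x_0)
  next
    case (Suc j)
    then have j: "j < k" by simp
    show ?thesis unfolding Suc x_Suc
      by (intro integrable_scaleR_right Bochner_Integration.integrable_add less(4) j z[unfolded Suc])
  qed
qed

end

section \<open>Summation of the increments along a run\<close>

context stm_problem
begin

text \<open>The weight multiplying error k, a function of the samples before k. There is no
  minimiser before iteration 0, so \<open>xstart\<close> stands in; as it is also the first query
  point, \<open>stm_B\<close> still dominates its distance.\<close>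

definition past_dist :: "nat \<Rightarrow> (nat \<Rightarrow> 's) \<Rightarrow> real" where
  "past_dist k s = (case k of 0 \<Rightarrow> norm (xstart - xstar) | Suc j \<Rightarrow> norm (z s j - xstar))"

lemma past_dist_simps:
  "past_dist 0 s = norm (xstart - xstar)" "past_dist (Suc k) s = norm (z s k - xstar)"
  by (simp_all add: past_dist_def)

lemma gap_le_sum:
  "gap s N \<le> (norm (xstart - xstar))\<^sup>2 / 2
     + (\<Sum>k\<le>N. \<alpha> k * (norm (err s k) * past_dist k s) + A k / L * (norm (err s k))\<^sup>2)"
proof (induction N)
  case 0
  show ?case using gap_0_le[of s] by (simp add: past_dist_simps)
next
  case (Suc N)
  then show ?case using gap_Suc_le[of s N]
    by (simp add: past_dist_simps mult.assoc del: stm_A.simps stm_alpha.simps)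
qed

lemma gap_le_sum_half:
  assumes "m = \<mu> / 2" "\<mu> > 0"
  shows "gap s N \<le> (norm (xstart - xstar))\<^sup>2 / 2
     + (\<Sum>k\<le>N. A k * (1 / L + 1 / \<mu>) * (norm (err s k))\<^sup>2)"
proof (induction N)
  case 0
  show ?case using gap_0_le_half[OF assms, of s] by simp
next
  case (Suc N)
  then show ?case using gap_Suc_le_half[OF assms, of s N]
    by (simp del: stm_A.simps stm_alpha.simps)
qed

lemma output_le_gap: "A N * (f (x s N) - f xstar) \<le> gap s N"
proof -
  have "0 \<le> (1 + m * A N) / 2 * (norm (xstar - z s N))\<^sup>2"
    using quadratic_coeff_pos[of N] by simp
  then show ?thesis using gap_ge[of N s] by linarith
qed

text \<open>The errors are first estimated at z_0 and z_1 themselves. Of q v = q u + q (v - u) only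
  the second part enters the quadratic form: q u already pairs the second error with z_0, which is
  known before that error occurs.\<close>

lemma output_1_le:
  assumes m0: "m = 0"
  shows "A 1 * (f (x s 1) - f xstar) \<le> (norm (xstart - xstar))\<^sup>2
     + \<alpha> 1 * (norm (err s 1) * past_dist 1 s) + 3 / 5 * \<alpha> 0 * (norm (err s 0) * past_dist 0 s)
     + 3 / 5 * (\<alpha> 0)\<^sup>2 * (norm (err s 0))\<^sup>2 + 3 / 5 * (\<alpha> 1)\<^sup>2 * (norm (err s 1))\<^sup>2"
proof -
  define r where "r = norm (xstart - xstar)"
  define u where "u = norm (z s 0 - xstar)"
  define v where "v = norm (z s 1 - xstar)"
  define p where "p = \<alpha> 0 * norm (err s 0)"
  define q where "q = \<alpha> 1 * norm (err s 1)"
  have pos: "p \<ge> 0" "q \<ge> 0" "r \<ge> 0"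
    using \<alpha>_pos[of 0] \<alpha>_pos[of 1] unfolding p_def q_def r_def by auto
  have "\<alpha> 0 * inner (err s 0) (xstar - z s 0) \<le> \<alpha> 0 * (norm (err s 0) * u)"
    using \<alpha>_pos[of 0] norm_cauchy_schwarz[of "err s 0" "xstar - z s 0"]
    unfolding u_def norm_minus_commute[of "z s 0"] by (intro mult_left_mono) auto
  then have 1: "\<alpha> 0 * inner (err s 0) (xstar - z s 0) \<le> p * u"
    unfolding p_def by (simp only: mult.assoc)
  have "\<alpha> 1 * inner (err s 1) (xstar - z s 1) \<le> \<alpha> 1 * (norm (err s 1) * v)"
    using \<alpha>_pos[of 1] norm_cauchy_schwarz[of "err s 1" "xstar - z s 1"]
    unfolding v_def norm_minus_commute[of "z s 1"] by (intro mult_left_mono) auto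
  then have 2: "\<alpha> 1 * inner (err s 1) (xstar - z s 1) \<le> q * v"
    unfolding q_def by (simp only: mult.assoc)
  have "\<bar>u - r\<bar> \<le> norm (z s 0 - xstart)"
    using norm_triangle_ineq3[of "z s 0 - xstar" "xstart - xstar"] by (simp add: u_def r_def)
  then have 3: "(u - r)\<^sup>2 \<le> (norm (z s 0 - xstart))\<^sup>2"
    by (metis abs_le_square_iff abs_norm_cancel)
  have "\<bar>v - u\<bar> \<le> norm (z s 1 - z s 0)"
    using norm_triangle_ineq3[of "z s 1 - xstar" "z s 0 - xstar"] by (simp add: u_def v_def)
  then have 4: "(v - u)\<^sup>2 \<le> (norm (z s 1 - z s 0))\<^sup>2"
    by (metis abs_le_square_iff abs_norm_cancel)
  have "\<alpha> 0 * (\<mu> - m) / 2 * (norm (xstar - xstart))\<^sup>2 \<ge> 0"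
    using \<alpha>_pos[of 0] m by (intro mult_nonneg_nonneg divide_nonneg_nonneg) auto
  then have 5: "gap s 0 \<le> r\<^sup>2 / 2 + p * u - (u - r)\<^sup>2 / 4"
    using gap_0[of s] 1 3 unfolding r_def by linarith
  have "A 0 * \<mu> / 2 * (norm (x s 0 - xt s 1))\<^sup>2 \<ge> 0"
    using A_pos[of 0] m by (intro mult_nonneg_nonneg divide_nonneg_nonneg) auto
  moreover have "\<alpha> 1 * (\<mu> - m) / 2 * (norm (xstar - xt s 1))\<^sup>2 \<ge> 0"
    using \<alpha>_pos[of 1] m by (intro mult_nonneg_nonneg divide_nonneg_nonneg) auto
  moreover have "gap s 1 \<le> gap s 0 + \<alpha> 1 * inner (err s 1) (xstar - z s 1)
     - 1 / 4 * (norm (z s 1 - z s 0))\<^sup>2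
     - A 0 * \<mu> / 2 * (norm (x s 0 - xt s 1))\<^sup>2 - \<alpha> 1 * (\<mu> - m) / 2 * (norm (xstar - xt s 1))\<^sup>2"
    using gap_Suc[of s 0] unfolding m0 One_nat_def by simp
  ultimately have "gap s 1 \<le> gap s 0 + q * v - (v - u)\<^sup>2 / 4" using 2 4 by linarith
  moreover have "A 1 * (f (x s 1) - f xstar) + v\<^sup>2 / 2 \<le> gap s 1"
    using gap_ge[of 1 s] unfolding v_def norm_minus_commute[of xstar] m0 by simp
  \<comment> \<open>Expanding this square produces the linear term r/2 u, hence g = p + r/2 in
    \<open>young_chain\<close>. The squares of r then add up to 1/2 - 1/4 + 3/20 = 2/5 of r^2, below
    the claimed 1.\<close>
  moreover have "(u - r)\<^sup>2 / 4 = u\<^sup>2 / 4 - r / 2 * u + r\<^sup>2 / 4"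
    by (simp add: power2_eq_square field_simps)
  moreover have "(p + r / 2) * u = p * u + r / 2 * u" "q * v = q * u + q * (v - u)"
    by (simp_all add: algebra_simps)
  moreover have "(p + r / 2) * u + q * (v - u) - u\<^sup>2 / 4 - (v - u)\<^sup>2 / 4 - v\<^sup>2 / 2
      \<le> 3 / 5 * (p + r / 2)\<^sup>2 + 3 / 5 * q\<^sup>2"
    using pos by (intro young_chain) auto
  moreover have "(p + r / 2)\<^sup>2 = p\<^sup>2 + p * r + r\<^sup>2 / 4"
    by (simp add: power2_eq_square algebra_simps)
  moreover have "0 \<le> r\<^sup>2" by simp
  ultimately have "A 1 * (f (x s 1) - f xstar)
      \<le> r\<^sup>2 + q * u + 3 / 5 * (p * r) + 3 / 5 * p\<^sup>2 + 3 / 5 * q\<^sup>2"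
    using 5 by linarith
  moreover have "q * u = \<alpha> 1 * (norm (err s 1) * past_dist 1 s)"
    using past_dist_simps(2)[of 0 s] unfolding q_def u_def One_nat_def by (simp only: mult.assoc)
  moreover have "3 / 5 * (p * r) = 3 / 5 * \<alpha> 0 * (norm (err s 0) * past_dist 0 s)"
    unfolding p_def r_def past_dist_simps by (simp only: mult.assoc)
  moreover have "3 / 5 * p\<^sup>2 = 3 / 5 * (\<alpha> 0)\<^sup>2 * (norm (err s 0))\<^sup>2"
    "3 / 5 * q\<^sup>2 = 3 / 5 * (\<alpha> 1)\<^sup>2 * (norm (err s 1))\<^sup>2"
    unfolding p_def q_def by (simp_all only: power_mult_distrib mult.assoc)
  ultimately show ?thesis unfolding r_def by linarith
qed

text \<open>Adding strong convexity in both directions gives strong monotonicity of the gradient, to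
  be compared with its Lipschitz bound. A second point is essential: on a singleton both conditions
  hold for every \<mu>.\<close>

lemma mu_le:
  assumes "u \<in> Q" "u \<noteq> xstar"
  shows "\<mu> \<le> L / 2"
proof -
  have n: "norm (u - xstar) > 0" using assms by simp
  have "f u + inner (grad u) (xstar - u) + \<mu> / 2 * (norm (u - xstar))\<^sup>2 \<le> f xstar"
    "f xstar + inner (grad xstar) (u - xstar) + \<mu> / 2 * (norm (u - xstar))\<^sup>2 \<le> f u"
    using strongly_convex[OF assms(1) xstar(1)] strongly_convex[OF xstar(1) assms(1)]
    by (simp_all add: norm_minus_commute)
  then have "\<mu> * (norm (u - xstar))\<^sup>2 \<le> inner (grad u - grad xstar) (u - xstar)"
    by (simp add: inner_diff)
  also have "\<dots> \<le> norm (grad u - grad xstar) * norm (u - xstar)" by (rule norm_cauchy_schwarz)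
  also have "\<dots> \<le> L / 2 * norm (u - xstar) * norm (u - xstar)"
    by (intro mult_right_mono smooth assms xstar) auto
  finally have "\<mu> * (norm (u - xstar))\<^sup>2 \<le> L / 2 * (norm (u - xstar))\<^sup>2"
    by (simp add: power2_eq_square)
  then show ?thesis using n by simp
qed

end

section \<open>Bounds in expectation\<close>

lemma stm_B_ge:
  assumes "j \<le> N"
  shows "(\<integral>\<omega>. norm (z j \<omega> - xstar) \<partial>M) \<le> stm_B M xstar z x xt N"
    and "(\<integral>\<omega>. norm (xt j \<omega> - xstar) \<partial>M) \<le> stm_B M xstar z x xt N"
proof -
  define b where "b j = Max {(\<integral>\<omega>. norm (z j \<omega> - xstar) \<partial>M), (\<integral>\<omega>. norm (x j \<omega> - xstar) \<partial>M),
    (\<integral>\<omega>. norm (xt j \<omega> - xstar) \<partial>M)}" for j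
  have "b j \<le> stm_B M xstar z x xt N"
    unfolding stm_B_def b_def[symmetric] using assms by (intro Max_ge) auto
  moreover have "(\<integral>\<omega>. norm (z j \<omega> - xstar) \<partial>M) \<le> b j" "(\<integral>\<omega>. norm (xt j \<omega> - xstar) \<partial>M) \<le> b j"
    unfolding b_def by (intro Max_ge; simp)+
  ultimately show "(\<integral>\<omega>. norm (z j \<omega> - xstar) \<partial>M) \<le> stm_B M xstar z x xt N"
    "(\<integral>\<omega>. norm (xt j \<omega> - xstar) \<partial>M) \<le> stm_B M xstar z x xt N"
    by linarith+
qed

context stm_stochastic
begin

abbreviation "bound N \<equiv> stm_B M xstar (\<lambda>k \<omega>. z (seq \<omega>) k) (\<lambda>k \<omega>. x (seq \<omega>) k) (\<lambda>k \<omega>. xt (seq \<omega>) k) N"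

lemma past_dist_le_bound:
  assumes "k \<le> N"
  shows "(\<integral>\<omega>. past_dist k (seq \<omega>) \<partial>M) \<le> bound N"
proof (cases k)
  case 0
  have "(\<integral>\<omega>. norm (xt (seq \<omega>) 0 - xstar) \<partial>M) \<le> bound N"
    by (rule stm_B_ge(2)) simp
  then show ?thesis unfolding 0 xt_0 past_dist_simps .
next
  case (Suc j)
  have "(\<integral>\<omega>. norm (z (seq \<omega>) j - xstar) \<partial>M) \<le> bound N"
    using assms Suc by (intro stm_B_ge(1)) simp
  then show ?thesis unfolding Suc past_dist_simps .
qed

lemma bound_nonneg: "0 \<le> bound N"
  using past_dist_le_bound[of 0 N] by (simp add: past_dist_simps prob_space order_trans[OF norm_ge_zero])

lemma err_past_dist:
  "integrable M (\<lambda>\<omega>. norm (err (seq \<omega>) k) * past_dist k (seq \<omega>))"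
  "k \<le> N \<Longrightarrow> (\<integral>\<omega>. norm (err (seq \<omega>) k) * past_dist k (seq \<omega>) \<partial>M) \<le> \<delta> * bound N"
proof -
  have V: "past_dist k \<in> borel_measurable (PiM {..<k} (\<lambda>_. S))"
    "\<And>s. 0 \<le> past_dist k s" "\<And>s. past_dist k (restrict s {..<k}) = past_dist k s"
    "integrable M (\<lambda>\<omega>. past_dist k (seq \<omega>))"
  proof -
    show "0 \<le> past_dist k s" for s by (cases k) (simp_all add: past_dist_simps)
    show "past_dist k (restrict s {..<k}) = past_dist k s" for s
    proof (cases k)
      case (Suc j)
      have "stm Q f G L m xstart (restrict s {..<k}) j = stm Q f G L m xstart s j"
        by (rule stm_cong) (simp add: Suc)
      then show ?thesis by (simp add: Suc past_dist_simps)
    qed (simp add: past_dist_simps)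
    show "past_dist k \<in> borel_measurable (PiM {..<k} (\<lambda>_. S))"
    proof (cases k)
      case (Suc j)
      have "(\<lambda>s. z s j) \<in> borel_measurable (PiM {..<k} (\<lambda>_. S))"
        by (rule state_measurable) (auto simp: Suc)
      then show ?thesis unfolding Suc past_dist_simps[abs_def] by measurable
    qed (simp add: past_dist_simps[abs_def])
    show "integrable M (\<lambda>\<omega>. past_dist k (seq \<omega>))"
    proof (cases k)
      case (Suc j)
      then show ?thesis using state_integrable(3)[of j] by (simp add: past_dist_simps)
    qed (simp add: past_dist_simps)
  qed
  show "integrable M (\<lambda>\<omega>. norm (err (seq \<omega>) k) * past_dist k (seq \<omega>))"
    by (rule err_mult_past(1)[OF V])
  have "(\<integral>\<omega>. norm (err (seq \<omega>) k) * past_dist k (seq \<omega>) \<partial>M) \<le> \<delta> * (\<integral>\<omega>. past_dist k (seq \<omega>) \<partial>M)"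
    by (rule err_mult_past(2)[OF V])
  also assume "k \<le> N"
  then have "\<delta> * (\<integral>\<omega>. past_dist k (seq \<omega>) \<partial>M) \<le> \<delta> * bound N"
    by (intro mult_left_mono past_dist_le_bound delta)
  finally show "(\<integral>\<omega>. norm (err (seq \<omega>) k) * past_dist k (seq \<omega>) \<partial>M) \<le> \<delta> * bound N" .
qed

text \<open>Optimality of \<open>xstar\<close> makes the weighted residual nonnegative, so it is
  squeezed between 0 and \<open>W\<close> and inherits integrability.\<close>

lemma expected_output:
  assumes le: "\<And>\<omega>. A N * (f (x (seq \<omega>) N) - f xstar) \<le> W \<omega>" and W: "integrable M W"
  shows "integrable M (\<lambda>\<omega>. f (x (seq \<omega>) N))"
    and "A N * ((\<integral>\<omega>. f (x (seq \<omega>) N) \<partial>M) - f xstar) \<le> (\<integral>\<omega>. W \<omega> \<partial>M)"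
proof -
  have meas: "(\<lambda>\<omega>. f (x (seq \<omega>) N)) \<in> borel_measurable M"
    by (rule continuous_compose[OF f_continuous state_random_variable(4) x_in])
  have diff: "integrable M (\<lambda>\<omega>. A N * (f (x (seq \<omega>) N) - f xstar))"
  proof (rule Bochner_Integration.integrable_bound[OF W])
    show "(\<lambda>\<omega>. A N * (f (x (seq \<omega>) N) - f xstar)) \<in> borel_measurable M"
      using meas by measurable
    have "0 \<le> A N * (f (x (seq \<omega>) N) - f xstar)" for \<omega>
      using A_pos[of N] xstar(2)[OF x_in] by (intro mult_nonneg_nonneg) auto
    then show "AE \<omega> in M. norm (A N * (f (x (seq \<omega>) N) - f xstar)) \<le> norm (W \<omega>)"
      using le by (intro AE_I2) (smt (verit) real_norm_def)
  qed
  then have "integrable M (\<lambda>\<omega>. (1 / A N) * (A N * (f (x (seq \<omega>) N) - f xstar)) + f xstar)"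
    by (intro Bochner_Integration.integrable_add integrable_mult_right) auto
  then show int: "integrable M (\<lambda>\<omega>. f (x (seq \<omega>) N))"
    using A_pos[of N] by simp
  have "A N * ((\<integral>\<omega>. f (x (seq \<omega>) N) \<partial>M) - f xstar) = (\<integral>\<omega>. A N * (f (x (seq \<omega>) N) - f xstar) \<partial>M)"
    using int by (simp add: prob_space)
  also have "\<dots> \<le> (\<integral>\<omega>. W \<omega> \<partial>M)" by (rule integral_mono[OF diff W le])
  finally show "A N * ((\<integral>\<omega>. f (x (seq \<omega>) N) \<partial>M) - f xstar) \<le> (\<integral>\<omega>. W \<omega> \<partial>M)" .
qed

lemma expected_output_bound:
  "integrable M (\<lambda>\<omega>. f (x (seq \<omega>) N))"
  "A N * ((\<integral>\<omega>. f (x (seq \<omega>) N) \<partial>M) - f xstar)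
     \<le> (norm (xstart - xstar))\<^sup>2 / 2 + (\<Sum>k\<le>N. A k) * (\<delta>\<^sup>2 / L) + A N * (bound N * \<delta>)"
proof -
  define U where "U k \<omega> = \<alpha> k * (norm (err (seq \<omega>) k) * past_dist k (seq \<omega>))
    + A k / L * (norm (err (seq \<omega>) k))\<^sup>2" for k \<omega>
  define W where "W \<omega> = (norm (xstart - xstar))\<^sup>2 / 2 + (\<Sum>k\<le>N. U k \<omega>)" for \<omega>
  have U: "integrable M (U k)" for k
    unfolding U_def
    by (intro Bochner_Integration.integrable_add integrable_mult_right err_past_dist err_square)
  have W: "integrable M W"
    unfolding W_def by (intro Bochner_Integration.integrable_add Bochner_Integration.integrable_sum
        integrable_const U)
  have le: "A N * (f (x (seq \<omega>) N) - f xstar) \<le> W \<omega>" for \<omega>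
    unfolding W_def U_def by (rule order_trans[OF output_le_gap gap_le_sum])
  note * = expected_output[OF le W]
  show "integrable M (\<lambda>\<omega>. f (x (seq \<omega>) N))" by (rule *(1))
  have E_U: "(\<integral>\<omega>. U k \<omega> \<partial>M) \<le> \<alpha> k * (\<delta> * bound N) + A k / L * \<delta>\<^sup>2" if "k \<le> N" for k
  proof -
    have "(\<integral>\<omega>. U k \<omega> \<partial>M) = \<alpha> k * (\<integral>\<omega>. norm (err (seq \<omega>) k) * past_dist k (seq \<omega>) \<partial>M)
        + A k / L * (\<integral>\<omega>. (norm (err (seq \<omega>) k))\<^sup>2 \<partial>M)"
      unfolding U_def
      using Bochner_Integration.integral_add[OF integrable_mult_right[OF err_past_dist(1)]
          integrable_mult_right[OF err_square(1)], of "\<alpha> k" k "A k / L" k]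
      unfolding integral_mult_right_zero .
    also have "\<dots> \<le> \<alpha> k * (\<delta> * bound N) + A k / L * \<delta>\<^sup>2"
      using \<alpha>_pos[of k] A_pos[of k] L that
      by (intro add_mono mult_left_mono err_past_dist err_square) auto
    finally show ?thesis .
  qed
  have "(\<integral>\<omega>. W \<omega> \<partial>M) = (norm (xstart - xstar))\<^sup>2 / 2 + (\<Sum>k\<le>N. (\<integral>\<omega>. U k \<omega> \<partial>M))"
    unfolding W_def using U
    by (subst Bochner_Integration.integral_add) (simp_all add: prob_space)
  also have "\<dots> \<le> (norm (xstart - xstar))\<^sup>2 / 2 + (\<Sum>k\<le>N. \<alpha> k * (\<delta> * bound N) + A k / L * \<delta>\<^sup>2)"
    using E_U by (intro add_left_mono sum_mono) auto
  \<comment> \<open>The \<alpha>_k sum to A_N, so division by A_N leaves the bias term with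
    coefficient 1, within the claimed 3.\<close>
  also have "(\<Sum>k\<le>N. \<alpha> k * (\<delta> * bound N) + A k / L * \<delta>\<^sup>2)
      = A N * (bound N * \<delta>) + (\<Sum>k\<le>N. A k) * (\<delta>\<^sup>2 / L)"
    unfolding sum.distrib stm_A_eq_sum[of L m N] sum_distrib_right
    by (intro arg_cong2[where f = "(+)"] sum.cong) (auto simp: mult.commute)
  finally show "A N * ((\<integral>\<omega>. f (x (seq \<omega>) N) \<partial>M) - f xstar)
     \<le> (norm (xstart - xstar))\<^sup>2 / 2 + (\<Sum>k\<le>N. A k) * (\<delta>\<^sup>2 / L) + A N * (bound N * \<delta>)"
    using *(2) by linarith
qed

lemma expected_output_bound_half:
  assumes "m = \<mu> / 2" "\<mu> > 0"
  shows "integrable M (\<lambda>\<omega>. f (x (seq \<omega>) N))"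
  "A N * ((\<integral>\<omega>. f (x (seq \<omega>) N) \<partial>M) - f xstar)
     \<le> (norm (xstart - xstar))\<^sup>2 / 2 + (\<Sum>k\<le>N. A k) * (\<delta>\<^sup>2 / L + \<delta>\<^sup>2 / \<mu>)"
proof -
  define U where "U k \<omega> = A k * (1 / L + 1 / \<mu>) * (norm (err (seq \<omega>) k))\<^sup>2" for k \<omega>
  define W where "W \<omega> = (norm (xstart - xstar))\<^sup>2 / 2 + (\<Sum>k\<le>N. U k \<omega>)" for \<omega>
  have U: "integrable M (U k)" for k
    unfolding U_def by (intro integrable_mult_right err_square)
  have W: "integrable M W"
    unfolding W_def by (intro Bochner_Integration.integrable_add Bochner_Integration.integrable_sum
        integrable_const U)
  have le: "A N * (f (x (seq \<omega>) N) - f xstar) \<le> W \<omega>" for \<omega>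
    unfolding W_def U_def by (rule order_trans[OF output_le_gap gap_le_sum_half[OF assms]])
  note * = expected_output[OF le W]
  show "integrable M (\<lambda>\<omega>. f (x (seq \<omega>) N))" by (rule *(1))
  have E_U: "(\<integral>\<omega>. U k \<omega> \<partial>M) \<le> A k * (1 / L + 1 / \<mu>) * \<delta>\<^sup>2" for k
  proof -
    have "0 \<le> A k * (1 / L + 1 / \<mu>)" using A_pos[of k] L assms(2) by simp
    then show ?thesis unfolding U_def
      using mult_left_mono[OF err_square(2)[of k]] by simp
  qed
  have "(\<integral>\<omega>. W \<omega> \<partial>M) = (norm (xstart - xstar))\<^sup>2 / 2 + (\<Sum>k\<le>N. (\<integral>\<omega>. U k \<omega> \<partial>M))"
    unfolding W_def using U
    by (subst Bochner_Integration.integral_add) (simp_all add: prob_space)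
  also have "\<dots> \<le> (norm (xstart - xstar))\<^sup>2 / 2 + (\<Sum>k\<le>N. A k * (1 / L + 1 / \<mu>) * \<delta>\<^sup>2)"
    using E_U by (intro add_left_mono sum_mono) auto
  also have "(\<Sum>k\<le>N. A k * (1 / L + 1 / \<mu>) * \<delta>\<^sup>2) = (\<Sum>k\<le>N. A k) * (\<delta>\<^sup>2 / L + \<delta>\<^sup>2 / \<mu>)"
    unfolding sum_distrib_right by (intro sum.cong) (auto simp: algebra_simps)
  finally show "A N * ((\<integral>\<omega>. f (x (seq \<omega>) N) \<partial>M) - f xstar)
     \<le> (norm (xstart - xstar))\<^sup>2 / 2 + (\<Sum>k\<le>N. A k) * (\<delta>\<^sup>2 / L + \<delta>\<^sup>2 / \<mu>)"
    using *(2) by linarith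
qed

lemma expected_output_1_bound:
  assumes m0: "m = 0"
  shows "A 1 * ((\<integral>\<omega>. f (x (seq \<omega>) 1) \<partial>M) - f xstar)
     \<le> (norm (xstart - xstar))\<^sup>2 + A 1 * (\<delta>\<^sup>2 / L) + A 1 * (bound 1 * \<delta>)"
proof -
  define c0 where "c0 = 3 / 5 * \<alpha> 0"
  define d0 where "d0 = 3 / 5 * (\<alpha> 0)\<^sup>2"
  define d1 where "d1 = 3 / 5 * (\<alpha> 1)\<^sup>2"
  define P where "P k \<omega> = norm (err (seq \<omega>) k) * past_dist k (seq \<omega>)" for k \<omega>
  define E where "E k \<omega> = (norm (err (seq \<omega>) k))\<^sup>2" for k \<omega>
  define W where "W \<omega> = (norm (xstart - xstar))\<^sup>2 + \<alpha> 1 * P 1 \<omega> + c0 * P 0 \<omega> + d0 * E 0 \<omega> + d1 * E 1 \<omega>" for \<omega>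
  have int: "integrable M (P k)" "integrable M (E k)" for k
    unfolding P_def E_def by (intro err_past_dist err_square)+
  have W: "integrable M W" unfolding W_def
    by (intro Bochner_Integration.integrable_add integrable_mult_right integrable_const int)
  have le: "A 1 * (f (x (seq \<omega>) 1) - f xstar) \<le> W \<omega>" for \<omega>
    unfolding W_def P_def E_def c0_def d0_def d1_def by (rule output_1_le[OF m0])
  have nonneg: "0 \<le> \<alpha> 1" "0 \<le> c0" "0 \<le> d0" "0 \<le> d1"
    using \<alpha>_pos[of 0] \<alpha>_pos[of 1] unfolding c0_def d0_def d1_def by auto
  have E: "(\<integral>\<omega>. E k \<omega> \<partial>M) \<le> \<delta>\<^sup>2" for k unfolding E_def by (rule err_square)
  have P: "(\<integral>\<omega>. P k \<omega> \<partial>M) \<le> \<delta> * bound 1" if "k \<le> 1" for k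
    unfolding P_def using that by (rule err_past_dist)
  have "A 1 * ((\<integral>\<omega>. f (x (seq \<omega>) 1) \<partial>M) - f xstar) \<le> (\<integral>\<omega>. W \<omega> \<partial>M)"
    by (rule expected_output(2)[OF le W])
  also have "\<dots> = (norm (xstart - xstar))\<^sup>2 + \<alpha> 1 * (\<integral>\<omega>. P 1 \<omega> \<partial>M) + c0 * (\<integral>\<omega>. P 0 \<omega> \<partial>M)
      + d0 * (\<integral>\<omega>. E 0 \<omega> \<partial>M) + d1 * (\<integral>\<omega>. E 1 \<omega> \<partial>M)"
    unfolding W_def using int by (simp add: prob_space)
  also have "\<dots> \<le> (norm (xstart - xstar))\<^sup>2 + \<alpha> 1 * (\<delta> * bound 1) + c0 * (\<delta> * bound 1)
      + d0 * \<delta>\<^sup>2 + d1 * \<delta>\<^sup>2"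
    by (intro add_mono mult_left_mono order_refl E P nonneg) auto
  also have "\<dots> = (norm (xstart - xstar))\<^sup>2 + (\<alpha> 1 + c0) * (bound 1 * \<delta>) + (d0 + d1) * \<delta>\<^sup>2"
    by (simp add: algebra_simps)
  also have "\<dots> \<le> (norm (xstart - xstar))\<^sup>2 + A 1 * (bound 1 * \<delta>) + (A 1 / L) * \<delta>\<^sup>2"
  proof (intro add_mono order_refl mult_right_mono mult_nonneg_nonneg bound_nonneg delta)
    \<comment> \<open>Budget: 3/5 \<alpha>_0 is below 1 / L = A_0. Moreover \<alpha>_1^2 = A_1 / L,
      and A_1 >= 2 / L gives \<alpha>_0^2 <= A_1 / (2 L), so the squares cost 3/5 * (1 + 1/2) = 9/10
      of A_1 / L.\<close>
    have A1: "A 1 = 1 / L + \<alpha> 1" using A_Suc[of 0] by simp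
    then show "\<alpha> 1 + c0 \<le> A 1" unfolding c0_def using L by (simp add: field_simps)
    have "(\<alpha> 1)\<^sup>2 = A 1 / L" using A_root[of 0] L unfolding m0 One_nat_def
      by (simp add: field_simps del: stm_A.simps stm_alpha.simps)
    moreover have "1 / L \<le> \<alpha> 1"
      using stm_step_0_ge_inverse[of L "1 / L"] L unfolding m0 One_nat_def by simp
    then have "1 / L * (2 / L) \<le> 1 / L * A 1" using L unfolding A1 by (intro mult_left_mono) auto
    then have "(\<alpha> 0)\<^sup>2 \<le> 1 / 2 * (A 1 / L)" using L by (simp add: power2_eq_square field_simps)
    moreover have "0 \<le> A 1 / L" using A_pos[of 1] L by simp
    ultimately show "d0 + d1 \<le> A 1 / L" unfolding d0_def d1_def by linarith
  qed simp
  also have "(A 1 / L) * \<delta>\<^sup>2 = A 1 * (\<delta>\<^sup>2 / L)"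
    by (simp only: times_divide_eq_left times_divide_eq_right)
  finally show ?thesis by linarith
qed

end

section \<open>Division by the weights and the resulting rates\<close>

lemma weighted_estimate:
  fixes A b c D e P P' T :: real
  assumes "A > 0" "A * D \<le> P + T * e + A * b" "P \<le> A * P'" "T \<le> c * A" "e \<ge> 0"
  shows "D \<le> P' + c * e + b"
proof -
  have "T * e \<le> (c * A) * e" using assms by (intro mult_right_mono)
  then have "A * D \<le> A * (P' + c * e + b)" using assms by (simp add: algebra_simps)
  then show ?thesis using assms(1) by simp
qed

context stm_stochastic
begin

lemma exp_bound_output:
  assumes "m > 0" "m \<le> L" "norm (xstart - xstar) \<le> R"
  shows "(norm (xstart - xstar))\<^sup>2 / 2
    \<le> A N * (L * R\<^sup>2 * exp (- (1 / 2) * sqrt (m / L) * real N))"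
proof -
  define t where "t = 1 / 2 * sqrt (m / L) * real N"
  have "exp t \<le> L * A N" unfolding t_def using assms L by (intro stm_A_ge_exp) auto
  then have "exp t * exp (- t) \<le> (L * A N) * exp (- t)" by (intro mult_right_mono) auto
  then have "1 \<le> (L * A N) * exp (- t)" by (simp add: exp_minus_inverse)
  then have "R\<^sup>2 * 1 \<le> R\<^sup>2 * ((L * A N) * exp (- t))" by (intro mult_left_mono) auto
  moreover have "(norm (xstart - xstar))\<^sup>2 \<le> R\<^sup>2" using assms(3) by (intro power_mono) auto
  moreover have "0 \<le> (norm (xstart - xstar))\<^sup>2" by simp
  ultimately have "(norm (xstart - xstar))\<^sup>2 / 2 \<le> R\<^sup>2 * ((L * A N) * exp (- t))" by linarith
  also have "\<dots> = A N * (L * R\<^sup>2 * exp (- t))" by simp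
  finally show ?thesis by (simp add: t_def)
qed

text \<open>
  When \<open>Q\<close> is a single point, \<open>\<mu>\<close> may exceed \<open>L\<close> and the exponential lower bound on \<open>A\<close> fails.
\<close>

lemma singleton_output:
  assumes "\<And>u. u \<in> Q \<Longrightarrow> u = xstar"
  shows "integrable M (\<lambda>\<omega>. f (x (seq \<omega>) N))" "(\<integral>\<omega>. f (x (seq \<omega>) N) \<partial>M) - f xstar = 0"
  using assms[OF x_in] by (simp_all add: prob_space)

lemma expected_output_strongly_convex:
  assumes m: "m = \<mu>" "m > 0" and R: "norm (xstart - xstar) \<le> R"
  shows "integrable M (\<lambda>\<omega>. f (x (seq \<omega>) N)) \<and> (\<integral>\<omega>. f (x (seq \<omega>) N) \<partial>M) - f xstar
    \<le> L * R\<^sup>2 * exp (- (1 / 2) * sqrt (m / L) * real N)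
      + (1 + sqrt (L / m)) * (\<delta>\<^sup>2 / L) + 3 * bound N * \<delta>"
proof (cases "\<exists>u\<in>Q. u \<noteq> xstar")
  case True
  then have "m \<le> L" using mu_le m L by fastforce
  have "(\<integral>\<omega>. f (x (seq \<omega>) N) \<partial>M) - f xstar
    \<le> L * R\<^sup>2 * exp (- (1 / 2) * sqrt (m / L) * real N)
      + (1 + sqrt (L / m)) * (\<delta>\<^sup>2 / L) + bound N * \<delta>"
    using expected_output_bound(2) exp_bound_output[OF m(2) \<open>m \<le> L\<close> R] sum_stm_A_le[OF L m(2)]
    by (rule weighted_estimate[OF A_pos]) (use L in simp)
  moreover have "0 \<le> bound N * \<delta>" by (intro mult_nonneg_nonneg bound_nonneg delta)
  ultimately show ?thesis using expected_output_bound(1) by auto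
next
  case False
  have "0 \<le> L * R\<^sup>2 * exp (- (1 / 2) * sqrt (m / L) * real N)"
    "0 \<le> (1 + sqrt (L / m)) * (\<delta>\<^sup>2 / L)" "0 \<le> bound N * \<delta>"
    using L m(2) by (auto intro!: mult_nonneg_nonneg bound_nonneg delta add_nonneg_nonneg)
  then show ?thesis using singleton_output[of N] False by auto
qed

lemma expected_output_strongly_convex_half:
  assumes m: "m = \<mu> / 2" "m > 0" and R: "norm (xstart - xstar) \<le> R"
  shows "integrable M (\<lambda>\<omega>. f (x (seq \<omega>) N)) \<and> (\<integral>\<omega>. f (x (seq \<omega>) N) \<partial>M) - f xstar
    \<le> L * R\<^sup>2 * exp (- (1 / 2) * sqrt (m / L) * real N)
      + (1 + sqrt (L / m)) * (\<delta>\<^sup>2 / L) + (1 + sqrt (L / m)) * (\<delta>\<^sup>2 / \<mu>)"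
proof (cases "\<exists>u\<in>Q. u \<noteq> xstar")
  case True
  have "\<mu> > 0" using m by simp
  note half = m(1) \<open>\<mu> > 0\<close>
  have "m \<le> L" using True mu_le m L by fastforce
  have "(\<integral>\<omega>. f (x (seq \<omega>) N) \<partial>M) - f xstar
    \<le> L * R\<^sup>2 * exp (- (1 / 2) * sqrt (m / L) * real N)
      + (1 + sqrt (L / m)) * (\<delta>\<^sup>2 / L + \<delta>\<^sup>2 / \<mu>) + 0"
  proof (rule weighted_estimate[OF A_pos _ exp_bound_output[OF m(2) \<open>m \<le> L\<close> R] sum_stm_A_le[OF L m(2)]])
    show "A N * ((\<integral>\<omega>. f (x (seq \<omega>) N) \<partial>M) - f xstar)
       \<le> (norm (xstart - xstar))\<^sup>2 / 2 + (\<Sum>k\<le>N. A k) * (\<delta>\<^sup>2 / L + \<delta>\<^sup>2 / \<mu>) + A N * 0"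
      using expected_output_bound_half(2)[OF half] by simp
  qed (use L half in simp)
  then show ?thesis using expected_output_bound_half(1)[OF half] by (simp add: distrib_left)
next
  case False
  have "0 \<le> L * R\<^sup>2 * exp (- (1 / 2) * sqrt (m / L) * real N)"
    "0 \<le> (1 + sqrt (L / m)) * (\<delta>\<^sup>2 / L)" "0 \<le> (1 + sqrt (L / m)) * (\<delta>\<^sup>2 / \<mu>)"
    using L m by (auto intro!: mult_nonneg_nonneg add_nonneg_nonneg)
  then show ?thesis using singleton_output[of N] False by auto
qed

lemma expected_output_convex:
  assumes m0: "m = 0" and R: "norm (xstart - xstar) \<le> R" and N: "N \<ge> 1"
  shows "integrable M (\<lambda>\<omega>. f (x (seq \<omega>) N)) \<and> (\<integral>\<omega>. f (x (seq \<omega>) N) \<partial>M) - f xstar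
    \<le> 4 * L * R\<^sup>2 / (real N)\<^sup>2 + 3 * bound N * \<delta> + real N * (\<delta>\<^sup>2 / L)"
proof -
  define r where "r = norm (xstart - xstar)"
  have r: "r\<^sup>2 \<le> R\<^sup>2" unfolding r_def using R by (intro power_mono) auto
  \<comment> \<open>The lower bound on A_N is weakened from (N + 1)^2 to N^2 so that R^2 becomes at
    most A_N times the claimed leading term.\<close>
  have "(real N)\<^sup>2 / (4 * L) \<le> (real N + 1)\<^sup>2 / (4 * L)"
    using L by (intro divide_right_mono power_mono) auto
  also have "\<dots> \<le> A N" unfolding m0 by (rule stm_A_0_ge[OF L])
  finally have "(real N)\<^sup>2 / (4 * L) * (4 * L * R\<^sup>2 / (real N)\<^sup>2) \<le> A N * (4 * L * R\<^sup>2 / (real N)\<^sup>2)"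
    using L by (intro mult_right_mono) auto
  moreover have "(real N)\<^sup>2 / (4 * L) * (4 * L * R\<^sup>2 / (real N)\<^sup>2) = R\<^sup>2"
    using L N by simp
  ultimately have start: "r\<^sup>2 \<le> A N * (4 * L * R\<^sup>2 / (real N)\<^sup>2)" using r by linarith
  have "A N * ((\<integral>\<omega>. f (x (seq \<omega>) N) \<partial>M) - f xstar)
      \<le> r\<^sup>2 + (real N * A N) * (\<delta>\<^sup>2 / L) + A N * (bound N * \<delta>)"
  proof (cases "N = 1")
    case True
    show ?thesis using expected_output_1_bound[OF m0] unfolding True r_def by simp
  next
    case False
    then have "(\<Sum>k\<le>N. A k) * (\<delta>\<^sup>2 / L) \<le> (real N * A N) * (\<delta>\<^sup>2 / L)"
      unfolding m0 using N L by (intro mult_right_mono sum_stm_A_0_le) auto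
    moreover have "r\<^sup>2 / 2 \<le> r\<^sup>2" by simp
    ultimately show ?thesis using expected_output_bound(2)[of N] unfolding r_def by linarith
  qed
  then have "(\<integral>\<omega>. f (x (seq \<omega>) N) \<partial>M) - f xstar
      \<le> 4 * L * R\<^sup>2 / (real N)\<^sup>2 + real N * (\<delta>\<^sup>2 / L) + bound N * \<delta>"
    by (rule weighted_estimate[OF A_pos _ start order_refl]) (use L in simp)
  moreover have "0 \<le> bound N * \<delta>" by (intro mult_nonneg_nonneg bound_nonneg delta)
  ultimately show ?thesis using expected_output_bound(1) by auto
qed

end

theorem theorem6p3:
  fixes Q :: "'a::euclidean_space set"
    and f :: "'a \<Rightarrow> real"
    and grad :: "'a \<Rightarrow> 'a"
    and G :: "'a \<Rightarrow> 's \<Rightarrow> 'a"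
    and M :: "'w measure"
    and S :: "'s measure"
    and \<xi> :: "nat \<Rightarrow> 'w \<Rightarrow> 's"
    and xstart xstar :: 'a
    and Lf L \<mu> \<mu>1 \<mu>2 \<delta> \<delta>1 \<delta>2 \<delta>3 R :: real
    and x xt z :: "real \<Rightarrow> nat \<Rightarrow> 'w \<Rightarrow> 'a"
  assumes Q: "closed Q" "convex Q"
    and xstart: "xstart \<in> Q"
    and grad: "\<And>u. u \<in> Q \<Longrightarrow> (f has_derivative (\<lambda>h. inner (grad u) h)) (at u within Q)"
    and Lf: "Lf > 0"
    and smooth: "\<And>u v. u \<in> Q \<Longrightarrow> v \<in> Q \<Longrightarrow> norm (grad u - grad v) \<le> Lf * norm (u - v)"
    and mu: "\<mu> \<ge> 0"
    and strongly_convex: "\<And>u v. u \<in> Q \<Longrightarrow> v \<in> Q \<Longrightarrow>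
          f u + inner (grad u) (v - u) + \<mu> / 2 * (norm (u - v))\<^sup>2 \<le> f v"
    and xstar: "is_arg_min f (\<lambda>u. u \<in> Q) xstar"
    and xstar_closest:
          "is_arg_min (\<lambda>u. norm (u - xstart)) (is_arg_min f (\<lambda>u. u \<in> Q)) xstar"
    and R: "norm (xstart - xstar) \<le> R"
    and prob: "prob_space M"
    and indep: "prob_space.indep_vars M (\<lambda>_. S) \<xi> UNIV"
    and G_measurable:
          "(\<lambda>(u, s). G u s) \<in> borel_measurable (restrict_space borel Q \<Otimes>\<^sub>M S)"
    and delta: "\<delta> \<ge> 0"
    and variance: "\<And>k u. u \<in> Q \<Longrightarrow>
          (\<integral>\<^sup>+ \<omega>. ennreal ((norm (G u (\<xi> k \<omega>) - grad u))\<^sup>2) \<partial>M) \<le> ennreal (\<delta>\<^sup>2)"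
    and constants: "L = 2 * Lf" "\<delta>1 = \<delta>" "\<delta>2 = \<delta>\<^sup>2 / L" "\<delta>3 = \<delta>\<^sup>2 / \<mu>" "\<mu>1 = \<mu>" "\<mu>2 = \<mu> / 2"
    and xt_def: "\<And>m k \<omega>. xt m k \<omega> = query_point (stm Q f G L m xstart (\<lambda>i. \<xi> i \<omega>) k)"
    and z_def: "\<And>m k \<omega>. z m k \<omega> = psi_minimiser (stm Q f G L m xstart (\<lambda>i. \<xi> i \<omega>) k)"
    and x_def: "\<And>m k \<omega>. x m k \<omega> = output_point (stm Q f G L m xstart (\<lambda>i. \<xi> i \<omega>) k)"
  shows "(\<mu> \<noteq> 0 \<longrightarrow>
      (\<forall>N. integrable M (\<lambda>\<omega>. f (x \<mu>1 N \<omega>)) \<and>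
        (\<integral>\<omega>. f (x \<mu>1 N \<omega>) \<partial>M) - f xstar
          \<le> L * R\<^sup>2 * exp (- (1 / 2) * sqrt (\<mu>1 / L) * real N)
            + (1 + sqrt (L / \<mu>1)) * \<delta>2
            + 3 * stm_B M xstar (z \<mu>1) (x \<mu>1) (xt \<mu>1) N * \<delta>1) \<and>
      (\<forall>N. integrable M (\<lambda>\<omega>. f (x \<mu>2 N \<omega>)) \<and>
        (\<integral>\<omega>. f (x \<mu>2 N \<omega>) \<partial>M) - f xstar
          \<le> L * R\<^sup>2 * exp (- (1 / 2) * sqrt (\<mu>2 / L) * real N)
            + (1 + sqrt (L / \<mu>2)) * \<delta>2
            + (1 + sqrt (L / \<mu>2)) * \<delta>3)) \<and>
    (\<mu> = 0 \<longrightarrow>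
      (\<forall>N\<ge>1. integrable M (\<lambda>\<omega>. f (x 0 N \<omega>)) \<and>
        (\<integral>\<omega>. f (x 0 N \<omega>) \<partial>M) - f xstar
          \<le> 4 * L * R\<^sup>2 / (real N)\<^sup>2
            + 3 * stm_B M xstar (z 0) (x 0) (xt 0) N * \<delta>1
            + real N * \<delta>2))"
proof -
  have sols: "xstar \<in> Q" "\<And>u. u \<in> Q \<Longrightarrow> f xstar \<le> f u"
    using xstar unfolding is_arg_min_linorder by auto
  have "L > 0" using Lf constants by simp
  have run: "stm_stochastic Q f grad G xstart xstar L \<mu> m M S \<xi> \<delta>" if "0 \<le> m" "m \<le> \<mu>" for m
    unfolding stm_stochastic_def stm_problem_def stm_stochastic_axioms_def
    using Q xstart grad \<open>L > 0\<close> smooth strongly_convex that sols prob indep G_measurable delta variance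
      constants(1) by simp
  \<comment> \<open>Equations between functions, because \<open>stm_B\<close> takes whole sequences
    as arguments.\<close>
  have seqs: "x m = (\<lambda>k \<omega>. output_point (stm Q f G L m xstart (\<lambda>i. \<xi> i \<omega>) k))"
    "z m = (\<lambda>k \<omega>. psi_minimiser (stm Q f G L m xstart (\<lambda>i. \<xi> i \<omega>) k))"
    "xt m = (\<lambda>k \<omega>. query_point (stm Q f G L m xstart (\<lambda>i. \<xi> i \<omega>) k))" for m
    using x_def z_def xt_def by (simp_all add: fun_eq_iff)
  show ?thesis
    unfolding seqs constants(2-)
    using mu stm_stochastic.expected_output_strongly_convex[OF run _ _ R, of \<mu>]
      stm_stochastic.expected_output_strongly_convex_half[OF run _ _ R, of "\<mu> / 2"]
      stm_stochastic.expected_output_convex[OF run _ R, of 0]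
    by simp
qed

end
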